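(* Work in the Gaussian weak-GMM limit experiment of the context under the null $H_{0,a_0}:m(a_0)=0$, suppose $\Sigma_{00}=\Sigma(a_0,a_0)$ is nonsingular, and let the statistic $T_\lambda$ be measurable for every $\lambda\in\Lambda$. Fix $\zeta\in(0,1)$. Suppose that, on a residual-path set $\mathcal H_{0,a_0}$ that has probability one (for $h_{a_0}$) under every null nuisance mean, $$P_0^h[T_\lambda(g)>c_{\zeta,\lambda}(h)]+\rho_{\zeta,\lambda}(h)\,P_0^h[T_\lambda(g)=c_{\zeta,\lambda}(h)]=\zeta$$ for every $h\in\mathcal H_{0,a_0}$ and every $\lambda\in\Lambda$, where $P_0^h$ is the regular conditional null law, i.e. the law of $\alpha_W\mapsto h(\alpha_W)+V_{a_0}(\alpha_W)\xi$ with $\xi\sim N(0,\Sigma_{00})$. Then the test $$\varphi_{\lambda,a_0}(g)=\mathbf 1[T_\lambda(g)>c_{\zeta,\lambda}(h_{a_0})]+\rho_{\zeta,\lambda}(h_{a_0})\,\mathbf 1[T_\lambda(g)=c_{\zeta,\lambda}(h_{a_0})]$$ has conditional size $\zeta$ (given $h_{a_0}$) for every $\lambda\in\Lambda$, and $\mathbb E_{a_0,m}\varphi_{\lambda,a_0}(g)=\zeta$ for every null nuisance mean $m$ with $m(a_0)=0$.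
   Context: $\mathcal W\subset\mathbb R^{d_W}$ is compact, $a_0\in\mathcal W$, $\Lambda\subset[0,\bar\lambda]$ is compact. The Gaussian weak-GMM limit experiment observes $g=m+\mathbb G$ on $\mathcal W$ with values in $\mathbb R^{k_W}$, where $m$ is an unknown (nuisance) continuous mean function and $\mathbb G$ is a mean-zero Gaussian process with continuous sample paths and known covariance function $\Sigma(\alpha,\tilde\alpha)=\operatorname{Cov}(\mathbb G(\alpha),\mathbb G(\tilde\alpha))$. A null nuisance mean is an $m$ with $m(a_0)=0$; $\mathbb E_{a_0,m}$ is expectation under it. Set $V_{a_0}(\alpha_W)=\Sigma(\alpha_W,a_0)\Sigma_{00}^{-1}$ and the residual path $h_{a_0}(\alpha_W)=g(\alpha_W)-V_{a_0}(\alpha_W)g(a_0)$. $T_\lambda$ is a real-valued function of the path $g$; $c_{\zeta,\lambda}(h)\in\mathbb R$ and $\rho_{\zeta,\lambda}(h)\in[0,1]$ are (measurable) critical values and randomization probabilities depending on the residual path. *)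

theory Defs
  imports "HOL-Probability.Probability"
begin

text \<open>Paths on \<open>W\<close> are total functions that take the value \<open>undefined\<close> outside \<open>W\<close>
  (\<^const>\<open>extensional\<close>), so that equality of paths is equality on \<open>W\<close>.  The sigma-algebra is the one
  generated by the evaluations; for compact \<open>W\<close> it is the Borel sigma-algebra of the
  supremum distance on the continuous functions.\<close>

type_synonym ('d, 'k) path = "real ^ 'd \<Rightarrow> real ^ 'k"

definition path_space :: "(real ^ 'd) set \<Rightarrow> ('d::finite, 'k::finite) path measure" where
  "path_space W = restrict_space (Pi\<^sub>M W (\<lambda>_. borel)) {g. continuous_on W g}"

text \<open>Degenerate (almost surely constant) normal variables count as Gaussian.\<close>

definition gaussian_rv :: "'w measure \<Rightarrow> ('w \<Rightarrow> real) \<Rightarrow> bool" where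
  "gaussian_rv M X \<longleftrightarrow> X \<in> borel_measurable M \<and>
     ((\<exists>\<mu>. AE \<omega> in M. X \<omega> = \<mu>) \<or>
      (\<exists>\<mu> \<sigma>. 0 < \<sigma> \<and> distributed M lborel X (\<lambda>x. ennreal (normal_density \<mu> \<sigma> x))))"

definition cross_cov ::
  "'w measure \<Rightarrow> ('w \<Rightarrow> real ^ 'k) \<Rightarrow> ('w \<Rightarrow> real ^ 'l) \<Rightarrow> real ^ 'l::finite ^ 'k::finite" where
  "cross_cov M X Y = (\<chi> i j.
     \<integral>\<omega>. (X \<omega> $ i - (\<integral>\<omega>'. X \<omega>' $ i \<partial>M)) * (Y \<omega> $ j - (\<integral>\<omega>'. Y \<omega>' $ j \<partial>M)) \<partial>M)"

definition normal_vector ::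
  "'w measure \<Rightarrow> ('w \<Rightarrow> real ^ 'k::finite) \<Rightarrow> real ^ 'k \<Rightarrow> real ^ 'k ^ 'k \<Rightarrow> bool" where
  "normal_vector M X \<mu> C \<longleftrightarrow>
     X \<in> borel_measurable M \<and>
     (\<forall>u. gaussian_rv M (\<lambda>\<omega>. u \<bullet> X \<omega>)) \<and>
     (\<integral>\<omega>. X \<omega> \<partial>M) = \<mu> \<and> cross_cov M X X = C"

definition gaussian_process ::
  "'w measure \<Rightarrow> (real ^ 'd) set \<Rightarrow> ('w \<Rightarrow> ('d::finite, 'k::finite) path) \<Rightarrow> bool" where
  "gaussian_process M W G \<longleftrightarrow>
     (\<forall>\<alpha>\<in>W. (\<lambda>\<omega>. G \<omega> \<alpha>) \<in> borel_measurable M) \<and>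
     (\<forall>F u. finite F \<and> F \<subseteq> W \<longrightarrow> gaussian_rv M (\<lambda>\<omega>. \<Sum>\<alpha>\<in>F. u \<alpha> \<bullet> G \<omega> \<alpha>))"

text \<open>The standing assumptions on the process \<open>G\<close> of the limit experiment, with covariance
  function \<open>C\<close>.\<close>

definition limit_noise ::
  "'w measure \<Rightarrow> (real ^ 'd) set \<Rightarrow> ('w \<Rightarrow> ('d::finite, 'k::finite) path) \<Rightarrow>
   (real ^ 'd \<Rightarrow> real ^ 'd \<Rightarrow> real ^ 'k ^ 'k) \<Rightarrow> bool" where
  "limit_noise M W G C \<longleftrightarrow>
     prob_space M \<and> gaussian_process M W G \<and>
     (\<forall>\<omega>\<in>space M. continuous_on W (G \<omega>)) \<and>
     (\<forall>\<alpha>\<in>W. (\<integral>\<omega>. G \<omega> \<alpha> \<partial>M) = 0) \<and>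
     (\<forall>\<alpha>\<in>W. \<forall>\<beta>\<in>W. cross_cov M (\<lambda>\<omega>. G \<omega> \<alpha>) (\<lambda>\<omega>. G \<omega> \<beta>) = C \<alpha> \<beta>)"

text \<open>The law of the observed path \<open>g = m + G\<close>.\<close>

definition obs_law ::
  "'w measure \<Rightarrow> (real ^ 'd) set \<Rightarrow> ('w \<Rightarrow> ('d, 'k) path) \<Rightarrow> ('d, 'k) path \<Rightarrow>
   ('d::finite, 'k::finite) path measure" where
  "obs_law M W G m = distr M (path_space W) (\<lambda>\<omega>. restrict (\<lambda>\<alpha>. m \<alpha> + G \<omega> \<alpha>) W)"

definition null_mean ::
  "(real ^ 'd) set \<Rightarrow> real ^ 'd \<Rightarrow> ('d::finite, 'k::finite) path \<Rightarrow> bool" where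
  "null_mean W a0 m \<longleftrightarrow> continuous_on W m \<and> m a0 = 0"

definition V_coef ::
  "(real ^ 'd \<Rightarrow> real ^ 'd \<Rightarrow> real ^ 'k ^ 'k) \<Rightarrow> real ^ 'd::finite \<Rightarrow> real ^ 'd \<Rightarrow>
   real ^ 'k ^ 'k::finite" where
  "V_coef C a0 \<alpha> = C \<alpha> a0 ** matrix_inv (C a0 a0)"

definition residual ::
  "(real ^ 'd) set \<Rightarrow> (real ^ 'd \<Rightarrow> real ^ 'd \<Rightarrow> real ^ 'k ^ 'k) \<Rightarrow> real ^ 'd \<Rightarrow>
   ('d, 'k) path \<Rightarrow> ('d::finite, 'k::finite) path" where
  "residual W C a0 g = restrict (\<lambda>\<alpha>. g \<alpha> - V_coef C a0 \<alpha> *v g a0) W"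

definition residual_paths ::
  "(real ^ 'd) set \<Rightarrow> (real ^ 'd \<Rightarrow> real ^ 'd \<Rightarrow> real ^ 'k ^ 'k) \<Rightarrow> real ^ 'd \<Rightarrow>
   ('d::finite, 'k::finite) path set" where
  "residual_paths W C a0 = residual W C a0 ` space (path_space W)"

definition residual_space ::
  "(real ^ 'd) set \<Rightarrow> (real ^ 'd \<Rightarrow> real ^ 'd \<Rightarrow> real ^ 'k ^ 'k) \<Rightarrow> real ^ 'd \<Rightarrow>
   ('d::finite, 'k::finite) path measure" where
  "residual_space W C a0 = restrict_space (path_space W) (residual_paths W C a0)"

text \<open>The law of \<open>h + V \<xi>\<close>, where \<open>\<xi>\<close> is a random vector on the probability space \<open>Q\<close>.\<close>

definition cond_null_law ::
  "(real ^ 'd) set \<Rightarrow> (real ^ 'd \<Rightarrow> real ^ 'd \<Rightarrow> real ^ 'k ^ 'k) \<Rightarrow> real ^ 'd \<Rightarrow>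
   'q measure \<Rightarrow> ('q \<Rightarrow> real ^ 'k) \<Rightarrow> ('d, 'k) path \<Rightarrow> ('d::finite, 'k::finite) path measure" where
  "cond_null_law W C a0 Q \<xi> h =
     distr Q (path_space W) (\<lambda>q. restrict (\<lambda>\<alpha>. h \<alpha> + V_coef C a0 \<alpha> *v \<xi> q) W)"

text \<open>The randomised test with statistic \<open>T\<close>, and critical value \<open>c\<close> and randomisation
  probability \<open>\<rho>\<close> evaluated at the residual of the path.\<close>

definition cond_test ::
  "(real ^ 'd) set \<Rightarrow> (real ^ 'd \<Rightarrow> real ^ 'd \<Rightarrow> real ^ 'k ^ 'k) \<Rightarrow> real ^ 'd \<Rightarrow>
   (('d, 'k) path \<Rightarrow> real) \<Rightarrow> (('d, 'k) path \<Rightarrow> real) \<Rightarrow> (('d, 'k) path \<Rightarrow> real) \<Rightarrow>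
   ('d::finite, 'k::finite) path \<Rightarrow> real" where
  "cond_test W C a0 T c \<rho> g =
     of_bool (T g > c (residual W C a0 g)) +
     \<rho> (residual W C a0 g) * of_bool (T g = c (residual W C a0 g))"

text \<open>Conditional rejection probability of the test \<open>\<phi>\<close> given the residual path, when the observed
  path has law \<open>P\<close>.\<close>

definition cond_rejection ::
  "(real ^ 'd) set \<Rightarrow> (real ^ 'd \<Rightarrow> real ^ 'd \<Rightarrow> real ^ 'k ^ 'k) \<Rightarrow> real ^ 'd \<Rightarrow>
   ('d, 'k) path measure \<Rightarrow> (('d, 'k) path \<Rightarrow> real) \<Rightarrow> ('d::finite, 'k::finite) path \<Rightarrow> real" where
  "cond_rejection W C a0 P \<phi> =
     real_cond_exp P
       (vimage_algebra (space (path_space W)) (residual W C a0) (residual_space W C a0)) \<phi>"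

end

theory Submission
  imports Defs
begin

text \<open>Write \<open>P\<close> for the law of \<open>g\<close> under a null mean, \<open>h\<close> for the residual path and take \<open>\<xi>\<close>
  independent of \<open>g\<close>.  Then \<open>h + V \<xi>\<close> again has law \<open>P\<close>: for finitely many points both
  characteristic functions are Gaussian with the same mean and, because \<open>V\<close> makes the residual
  uncorrelated with \<open>g a0\<close>, the same variance; and a path law is determined by these
  characteristic functions.  Since \<open>h + V \<xi>\<close> has residual \<open>h\<close>, Fubini disintegrates \<open>P\<close> into the
  conditional null laws, so over every event of the residual the test integrates to \<open>\<zeta>\<close> times
  the probability of the event.\<close>

text \<open>Normality is given through linear functionals and may be degenerate, so no joint density
  is at hand and laws are compared by characteristic functions. The obstacle is uniqueness: Levy's
  theorem concerns probability laws on the line, while path laws require joint laws of vectors at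
  finitely many points. Restricting to an event of one coordinate destroys total mass one, which is
  why finite measures are used throughout. Independence of the residual and \<open>g a0\<close> is
  never stated on its own; only the law of the recombined path is compared with \<open>P\<close>.
  The means agree because of \<open>m a0 = 0\<close>: in general the mean of the residual is
  \<open>m\<close> minus \<open>V\<close> applied to \<open>m a0\<close>. Finally, recombined paths
  have to be continuous, but \<open>C\<close> is known only as a covariance, so the continuity of
  \<open>V\<close> in \<alpha> is extracted from that of the sample paths.\<close>

section \<open>Uniqueness of finite measures with given characteristic functions: line, Euclidean
  space, paths\<close>

text \<open>The transform at \<open>0\<close> is the total mass, so both measures have the same mass
  \<open>a\<close>. If \<open>a = 0\<close> both vanish; otherwise dividing by \<open>a\<close>
  gives probability laws, to which Levy's theorem applies.\<close>

lemma finite_measure_eqI_char: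
  fixes M N :: "real measure"
  assumes "finite_measure M" "finite_measure N"
    and sM: "sets M = sets borel" and sN: "sets N = sets borel"
    and eq: "\<And>t. (CLINT x|M. iexp (t \<bullet> x)) = (CLINT x|N. iexp (t \<bullet> x))"
  shows "M = N"
proof -
  interpret M: finite_measure M by fact
  interpret N: finite_measure N by fact
  have sp: "space M = UNIV" "space N = UNIV"
    using sets_eq_imp_space_eq[OF sM] sets_eq_imp_space_eq[OF sN] by auto
  define a where "a = measure M UNIV"
  have a: "measure M UNIV = a" "measure N UNIV = a"
    using eq[of 0] sp by (auto simp: a_def)
  have eM: "emeasure M UNIV = ennreal a" "emeasure N UNIV = ennreal a"
    using a by (auto simp: M.emeasure_eq_measure N.emeasure_eq_measure)
  show ?thesis
  proof (cases "a = 0")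
    case True
    show ?thesis
    proof (rule measure_eqI)
      fix A assume "A \<in> sets M"
      have "emeasure M A \<le> emeasure M UNIV" "emeasure N A \<le> emeasure N UNIV"
        using sM sN by (auto intro!: emeasure_mono)
      then show "emeasure M A = emeasure N A"
        using eM True by simp
    qed (simp add: sM sN)
  next
    case False
    then have a0: "a > 0" using a_def by (simp add: zero_less_measure_iff order_less_le)
    define S :: "real measure \<Rightarrow> real measure" where "S = (\<lambda>M. density M (\<lambda>_. ennreal (1 / a)))"
    have rd: "real_distribution (S L)" if "sets L = sets borel" "emeasure L UNIV = ennreal a" for L
    proof -
      have "space L = UNIV" using sets_eq_imp_space_eq[OF that(1)] by auto
      then have "emeasure (S L) (space (S L)) = 1"
        using that a0 by (simp add: S_def emeasure_density_const ennreal_mult[symmetric])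
      then show ?thesis
        using that(1) by (auto intro!: real_distribution.intro prob_spaceI
          simp: real_distribution_axioms_def S_def)
    qed
    have ch: "char (S L) t = (1/a) *\<^sub>R (CLINT x|L. iexp (t \<bullet> x))" if "sets L = sets borel" for L t
    proof -
      have [measurable_cong]: "sets L = sets borel" by fact
      show ?thesis unfolding char_def S_def
        by (subst integral_density) (use a0 in auto)
    qed
    have "S M = S N"
      by (rule Levy_uniqueness) (use rd sM sN eM ch eq in \<open>auto simp: fun_eq_iff\<close>)
    show ?thesis
    proof (rule measure_eqI)
      fix A assume A: "A \<in> sets M"
      have "ennreal a * emeasure (S L) A = emeasure L A" if "sets L = sets borel" for L
        using A that sM a0
        by (simp add: S_def emeasure_density_const mult.assoc[symmetric] ennreal_mult[symmetric])
      then show "emeasure M A = emeasure N A"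
        using \<open>S M = S N\<close> sM sN by metis
    qed (simp add: sM sN)
  qed
qed

text \<open>Take \<open>w\<close> as a density and push the weighted measure forward along
  \<open>f\<close>. The hypothesis equates the transforms of the two images, and the conclusion
  equates their masses of \<open>B\<close>. A density has to be nonnegative, and the bound
  \<open>K\<close> keeps the weighted measures finite.\<close>

lemma integral_indicator_weight_eqI:
  fixes f :: "'a \<Rightarrow> 'b::euclidean_space" and w :: "'a \<Rightarrow> real"
  assumes uniq: "\<And>M N :: 'b measure. finite_measure M \<Longrightarrow> finite_measure N \<Longrightarrow>
      sets M = sets borel \<Longrightarrow> sets N = sets borel \<Longrightarrow>
      (\<And>t. (CLINT x|M. iexp (t \<bullet> x)) = (CLINT x|N. iexp (t \<bullet> x))) \<Longrightarrow> M = N"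
    and fin: "finite_measure M" "finite_measure N" and sets_eq: "sets M = sets N"
    and f: "f \<in> borel_measurable M" and w: "w \<in> borel_measurable M"
    and bnd: "\<And>x. 0 \<le> w x" "\<And>x. w x \<le> K"
    and eq: "\<And>t. (CLINT x|M. w x * iexp (t \<bullet> f x)) = (CLINT x|N. w x * iexp (t \<bullet> f x))"
    and B: "B \<in> sets borel"
  shows "(LINT x|M. indicator B (f x) * w x) = (LINT x|N. indicator B (f x) * w x)"
proof -
  define D where "D = (\<lambda>L. distr (density L (\<lambda>x. ennreal (w x))) borel f)"
  have D: "finite_measure (D L)" "(CLINT x|D L. iexp (t \<bullet> x)) = (CLINT x|L. w x * iexp (t \<bullet> f x))"
    "measure (D L) B = (LINT x|L. indicator B (f x) * w x)"
    if "finite_measure L" "sets L = sets M" for L t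
  proof -
    interpret finite_measure L by fact
    have [measurable_cong]: "sets L = sets M" by fact
    note [measurable] = f w B
    have int: "integrable L w"
      by (rule integrable_const_bound[where B=K]) (use bnd in auto)
    have "finite_measure (density L (\<lambda>x. ennreal (w x)))"
      using int bnd by (intro finite_measureI)
          (auto simp: emeasure_density nn_integral_eq_integral cong: nn_integral_cong)
    then show fD: "finite_measure (D L)"
      unfolding D_def by (rule finite_measure.finite_measure_distr) simp
    show "(CLINT x|D L. iexp (t \<bullet> x)) = (CLINT x|L. w x * iexp (t \<bullet> f x))"
      unfolding D_def using bnd
      by (subst integral_distr) (auto simp: integral_density scaleR_conv_of_real)
    have "measure (D L) B = (LINT x|D L. indicator B x)"
      using fD by (simp add: D_def)
    also have "\<dots> = (LINT x|L. indicator B (f x) * w x)"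
      unfolding D_def using bnd
      by (subst integral_distr) (auto simp: integral_density mult.commute)
    finally show "measure (D L) B = (LINT x|L. indicator B (f x) * w x)" .
  qed
  have "D M = D N"
    by (rule uniq) (use D fin sets_eq eq in \<open>auto simp: D_def\<close>)
  then show ?thesis
    using D(3) fin sets_eq by metis
qed

text \<open>The uniqueness premise is first used for \<open>real\<close> to obtain it for Euclidean spaces, then for
  those. The coordinates are treated one at a time.  As uniqueness concerns positive measures, the factor
  \<open>iexp S\<close> of the remaining coordinates enters through the nonnegative weights \<open>1 + cos S\<close> and
  \<open>1 + sin S\<close>.\<close>

lemma measure_joint_eqI_char:
  fixes f :: "'i \<Rightarrow> 'a \<Rightarrow> 'b::euclidean_space"
  assumes uniq: "\<And>M N :: 'b measure. finite_measure M \<Longrightarrow> finite_measure N \<Longrightarrow>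
      sets M = sets borel \<Longrightarrow> sets N = sets borel \<Longrightarrow>
      (\<And>t. (CLINT x|M. iexp (t \<bullet> x)) = (CLINT x|N. iexp (t \<bullet> x))) \<Longrightarrow> M = N"
    and "finite I"
    and "finite_measure M" "finite_measure N" "sets M = sets N"
    and "\<And>i. i \<in> I \<Longrightarrow> f i \<in> borel_measurable M"
    and "\<And>t. (CLINT x|M. iexp (\<Sum>i\<in>I. t i \<bullet> f i x)) = (CLINT x|N. iexp (\<Sum>i\<in>I. t i \<bullet> f i x))"
    and "\<And>i. i \<in> I \<Longrightarrow> A i \<in> sets borel"
  shows "measure M {x \<in> space M. \<forall>i\<in>I. f i x \<in> A i} = measure N {x \<in> space N. \<forall>i\<in>I. f i x \<in> A i}"
  using assms(2-)
proof (induction I arbitrary: M N rule: finite_induct)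
  case empty
  interpret M: finite_measure M by fact
  interpret N: finite_measure N by fact
  show ?case using empty.prems(5)[of undefined] by simp
next
  case (insert j I)
  define B where "B = A j"
  define S where "S = (\<lambda>t x. \<Sum>i\<in>I. t i \<bullet> f i x)"
  have sp: "space N = space M"
    using insert.prems by (metis sets_eq_imp_space_eq)
  have [measurable]: "f j \<in> borel_measurable M" "B \<in> sets borel" "S t \<in> borel_measurable M" for t
    using insert.prems by (auto simp: B_def S_def)
  \<comment> \<open>The scalar \<open>r\<close> will be \<open>0\<close>, \<open>1\<close> and
    \<open>-1\<close>: the first drops the remaining coordinates, the other two give the
    exponentials that make up \<open>cos\<close> and \<open>sin\<close> of
    \<open>S t x\<close>.\<close>
  have joint: "(CLINT x|M. iexp (r * S t x + s \<bullet> f j x)) =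
      (CLINT x|N. iexp (r * S t x + s \<bullet> f j x))" for t s r
  proof -
    have "(\<Sum>i\<in>insert j I. (if i = j then s else r *\<^sub>R t i) \<bullet> f i x) = r * S t x + s \<bullet> f j x" for x
      using insert.hyps by (auto simp: S_def sum_distrib_left intro!: sum.cong)
    then show ?thesis
      using insert.prems(5)[of "\<lambda>i. if i = j then s else r *\<^sub>R t i"] by presburger
  qed
  have trans: "(LINT x|M. indicator B (f j x) * w x) = (LINT x|N. indicator B (f j x) * w x)"
    if "w \<in> borel_measurable M" "\<And>x. 0 \<le> w x" "\<And>x. w x \<le> 2"
     "\<And>t. (CLINT x|M. w x * iexp (t \<bullet> f j x)) = (CLINT x|N. w x * iexp (t \<bullet> f j x))"
         for w :: "'a \<Rightarrow> real"
    by (rule integral_indicator_weight_eqI[where K=2]) (use uniq insert.prems that in auto)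
  have int_iexp: "integrable L (\<lambda>x. iexp (g x))"
    if "L = M \<or> L = N" "g \<in> borel_measurable M" for L and g :: "'a \<Rightarrow> real"
  proof -
    interpret finite_measure L using that insert.prems by auto
    have [measurable_cong]: "sets L = sets M" using that insert.prems by auto
    show ?thesis
      by (rule integrable_const_bound[where B=1]) (use that in auto)
  qed
  have int_ind: "integrable L (\<lambda>x. indicator B (f j x) * g x :: real)"
    if "L = M \<or> L = N" "g \<in> borel_measurable M" "\<And>x. \<bar>g x\<bar> \<le> 1" for L and g :: "'a \<Rightarrow> real"
  proof -
    interpret finite_measure L using that insert.prems by auto
    have [measurable_cong]: "sets L = sets M" using that insert.prems by auto
    show ?thesis
      by (rule integrable_const_bound[where B=1]) (use that in \<open>auto split: split_indicator\<close>)
  qed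
  have one: "(LINT x|M. indicator B (f j x) * (1 :: real)) =
      (LINT x|N. indicator B (f j x) * (1 :: real))"
    by (rule trans) (use joint[of 0] in auto)
  define J where "J = (\<lambda>t s r x. iexp (r * S t x + s \<bullet> f j x))"
  have J_eq: "(CLINT x|M. J t s r x) = (CLINT x|N. J t s r x)" for t s r
    unfolding J_def by (rule joint)
  have J_int: "integrable M (J t s r)" "integrable N (J t s r)" for t s r
    unfolding J_def by (intro int_iexp; simp)+
  \<comment> \<open>Euler's formula: \<open>r = 1\<close> and \<open>r = -1\<close> produce the
    cosine and \<open>r = 0\<close> the summand \<open>1\<close>. The weighted transform is thus a
    combination of joint transforms, on which \<open>M\<close> and \<open>N\<close> agree.\<close>
  have cos_J: "complex_of_real (1 + cos (S t x)) * iexp (s \<bullet> f j x) =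
      J t s 0 x + (J t s 1 x + J t s (-1) x) / 2" for t s x
    by (simp add: J_def complex_eq_iff cos_add sin_add cos_diff sin_diff Re_exp Im_exp algebra_simps
        add_divide_distrib diff_divide_distrib)
  have sin_J: "complex_of_real (1 + sin (S t x)) * iexp (s \<bullet> f j x) =
      J t s 0 x + (J t s 1 x - J t s (-1) x) / (2 * \<i>)" for t s x
    by (simp add: J_def complex_eq_iff cos_add sin_add cos_diff sin_diff Re_exp Im_exp algebra_simps
        add_divide_distrib diff_divide_distrib Re_divide Im_divide)
  have cosw: "(LINT x|M. indicator B (f j x) * (1 + cos (S t x))) =
      (LINT x|N. indicator B (f j x) * (1 + cos (S t x)))" for t
  proof (rule trans)
    show "(CLINT x|M. complex_of_real (1 + cos (S t x)) * iexp (s \<bullet> f j x)) =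
        (CLINT x|N. complex_of_real (1 + cos (S t x)) * iexp (s \<bullet> f j x))" for s
      unfolding cos_J using J_int by (simp add: J_eq)
    show "0 \<le> 1 + cos (S t x)" for x
      using cos_ge_minus_one[of "S t x"] by linarith
  qed auto
  have sinw: "(LINT x|M. indicator B (f j x) * (1 + sin (S t x))) =
      (LINT x|N. indicator B (f j x) * (1 + sin (S t x)))" for t
  proof (rule trans)
    show "(CLINT x|M. complex_of_real (1 + sin (S t x)) * iexp (s \<bullet> f j x)) =
        (CLINT x|N. complex_of_real (1 + sin (S t x)) * iexp (s \<bullet> f j x))" for s
      unfolding sin_J using J_int by (simp add: J_eq)
    show "0 \<le> 1 + sin (S t x)" for x
      using sin_ge_minus_one[of "S t x"] by linarith
  qed auto
  \<comment> \<open>Subtracting the identity \<open>one\<close> for the weight \<open>1\<close>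
    leaves the signed factors themselves.\<close>
  have cs: "(LINT x|M. indicator B (f j x) * cos (S t x)) =
      (LINT x|N. indicator B (f j x) * cos (S t x))"
     "(LINT x|M. indicator B (f j x) * sin (S t x)) =
         (LINT x|N. indicator B (f j x) * sin (S t x))" for t
    using cosw[of t] sinw[of t] one int_ind[of _ "\<lambda>x. 1"]
      int_ind[of _ "\<lambda>x. cos (S t x)"] int_ind[of _ "\<lambda>x. sin (S t x)"]
    by (simp_all add: distrib_left)
  \<comment> \<open>Restriction to the event that coordinate \<open>j\<close> lies in
    \<open>B\<close>. By \<open>cs\<close> the restricted measures have equal transforms in the
    remaining coordinates, so the induction hypothesis applies to them in place of \<open>M\<close>
    and \<open>N\<close>.\<close>
  define D where "D = (\<lambda>L. density L (\<lambda>x. indicator B (f j x)))"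
  have D: "finite_measure (D L)" "(CLINT x|D L. iexp (S t x)) =
      Complex (LINT x|L. indicator B (f j x) * cos (S t x)) (LINT x|L. indicator B (f j x) * sin (S t x))"
    "measure (D L) {x \<in> space L. \<forall>i\<in>I. f i x \<in> A i} =
        measure L {x \<in> space L. \<forall>i\<in>insert j I. f i x \<in> A i}"
    if L: "L = M \<or> L = N" for L t
  proof -
    interpret finite_measure L using that insert.prems by auto
    have [measurable_cong]: "sets L = sets M" using that insert.prems by auto
    have [measurable]: "f i \<in> borel_measurable M" "A i \<in> sets borel" if "i \<in> I" for i
      using insert.prems that by auto
    have [measurable]: "finite I" by fact
    have dens: "D L = density L (\<lambda>x. ennreal (indicator B (f j x)))"
      by (simp add: D_def ennreal_indicator)
    have em: "emeasure (D L) X = emeasure L {x \<in> X. f j x \<in> B}" if "X \<in> sets M" for X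
    proof -
      have "emeasure (D L) X = (\<integral>\<^sup>+x. indicator B (f j x) * indicator X x \<partial>L)"
        unfolding D_def using that \<open>sets L = sets M\<close> by (intro emeasure_density) auto
      also have "\<dots> = (\<integral>\<^sup>+x. indicator {x \<in> X. f j x \<in> B} x \<partial>L)"
        by (intro nn_integral_cong) (auto split: split_indicator)
      also have "\<dots> = emeasure L {x \<in> X. f j x \<in> B}"
      proof (rule nn_integral_indicator)
        have "{x \<in> X. f j x \<in> B} = X \<inter> (f j -` B \<inter> space L)"
          using that \<open>sets L = sets M\<close> sets.sets_into_space by blast
        moreover have "f j -` B \<inter> space L \<in> sets L"
          by (rule measurable_sets[where A=borel]) measurable
        ultimately show "{x \<in> X. f j x \<in> B} \<in> sets L"
          using that \<open>sets L = sets M\<close> by (metis sets.Int)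
      qed
      finally show ?thesis .
    qed
    show "finite_measure (D L)"
    proof (rule finite_measureI)
      have "emeasure (D L) (space M) \<noteq> \<infinity>"
        using em[of "space M"] emeasure_finite by auto
      then show "emeasure (D L) (space (D L)) \<noteq> \<infinity>"
        using L sp by (auto simp: D_def)
    qed
    have "(CLINT x|D L. iexp (S t x)) = (CLINT x|L. indicator B (f j x) *\<^sub>R iexp (S t x))"
      unfolding dens by (subst integral_density) auto
    also have "\<dots> = (CLINT x|L. complex_of_real (indicator B (f j x) * cos (S t x)) +
        \<i> * complex_of_real (indicator B (f j x) * sin (S t x)))"
      by (intro Bochner_Integration.integral_cong) (auto simp: complex_eq_iff Re_exp Im_exp)
    also have "\<dots> =
        Complex (LINT x|L. indicator B (f j x) * cos (S t x)) (LINT x|L. indicator B (f j x) * sin (S t x))"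
      using int_ind[of L "\<lambda>x. cos (S t x)"] int_ind[of L "\<lambda>x. sin (S t x)"] L
      by (subst Bochner_Integration.integral_add) (auto simp del: of_real_mult simp: Complex_eq)
    finally show "(CLINT x|D L. iexp (S t x)) = \<dots>" .
    have "emeasure (D L) {x \<in> space L. \<forall>i\<in>I. f i x \<in> A i} =
        emeasure L {x \<in> {x \<in> space L. \<forall>i\<in>I. f i x \<in> A i}. f j x \<in> B}"
    proof (rule em)
      have "{x \<in> space L. \<forall>i\<in>I. f i x \<in> A i} \<in> sets L"
        by measurable
      then show "{x \<in> space L. \<forall>i\<in>I. f i x \<in> A i} \<in> sets M"
        by (simp add: \<open>sets L = sets M\<close>)
    qed
    moreover have "{x \<in> {x \<in> space L. \<forall>i\<in>I. f i x \<in> A i}. f j x \<in> B} =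
        {x \<in> space L. \<forall>i\<in>insert j I. f i x \<in> A i}"
      by (auto simp: B_def)
    ultimately show "measure (D L) {x \<in> space L. \<forall>i\<in>I. f i x \<in> A i} =
        measure L {x \<in> space L. \<forall>i\<in>insert j I. f i x \<in> A i}"
      by (simp add: measure_def)
  qed
  have "measure (D M) {x \<in> space (D M). \<forall>i\<in>I. f i x \<in> A i} =
      measure (D N) {x \<in> space (D N). \<forall>i\<in>I. f i x \<in> A i}"
  proof (rule insert.IH)
    show "(CLINT x|D M. iexp (\<Sum>i\<in>I. t i \<bullet> f i x)) = (CLINT x|D N. iexp (\<Sum>i\<in>I. t i \<bullet> f i x))" for t
      using D(2)[of M t] D(2)[of N t] cs[of t] by (simp add: S_def)
  qed (use D(1) insert.prems in \<open>auto simp: D_def\<close>)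
  then show ?case
    using D(3)[of M] D(3)[of N] by (simp add: D_def)
qed

text \<open>Open boxes form an intersection-stable generator, and a box is a joint event of the real
  coordinates \<open>x \<bullet> i\<close>. A linear combination of these coordinates is again an
  inner product with \<open>x\<close>, so the hypothesis covers their joint transform.\<close>

lemma finite_measure_eqI_char_euclidean:
  fixes M N :: "'b::euclidean_space measure"
  assumes "finite_measure M" "finite_measure N"
    and sM: "sets M = sets borel" and sN: "sets N = sets borel"
    and eq: "\<And>t. (CLINT x|M. iexp (t \<bullet> x)) = (CLINT x|N. iexp (t \<bullet> x))"
  shows "M = N"
proof -
  interpret M: finite_measure M by fact
  interpret N: finite_measure N by fact
  have sp: "space M = UNIV" "space N = UNIV"
    using sets_eq_imp_space_eq[OF sM] sets_eq_imp_space_eq[OF sN] by auto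
  have [measurable_cong]: "sets M = sets borel" "sets N = sets borel" by fact+
  show ?thesis
  proof (rule measure_eqI_generator_eq[where A="\<lambda>n::nat. box (- (real n *\<^sub>R One)) (real n *\<^sub>R One)"])
    show "Int_stable (range (\<lambda>(a, b). box a b :: 'b set))"
      by (auto simp: Int_stable_def box_Int_box)
    show "sets M = sigma_sets UNIV (range (\<lambda>(a, b). box a b))" "sets N =
        sigma_sets UNIV (range (\<lambda>(a, b). box a b))"
      by (simp_all add: sM sN borel_eq_box)
    show "(\<Union>n::nat. box (- (real n *\<^sub>R One)) (real n *\<^sub>R One)) = (UNIV :: 'b set)"
      by (rule UN_box_eq_UNIV)
    fix X :: "'b set" assume "X \<in> range (\<lambda>(a, b). box a b)"
    then obtain a b where X: "X = box a b" by auto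
    have "measure M {x \<in> space M. \<forall>i\<in>Basis. x \<bullet> i \<in> {a \<bullet> i<..<b \<bullet> i}} =
      measure N {x \<in> space N. \<forall>i\<in>Basis. x \<bullet> i \<in> {a \<bullet> i<..<b \<bullet> i}}"
    proof (rule measure_joint_eqI_char)
      show "(CLINT x|M. iexp (\<Sum>i\<in>Basis. t i \<bullet> (x \<bullet> i))) =
          (CLINT x|N. iexp (\<Sum>i\<in>Basis. t i \<bullet> (x \<bullet> i)))" for t
      proof -
        have "(\<Sum>i\<in>Basis. t i \<bullet> (x \<bullet> i)) = (\<Sum>i\<in>Basis. t i *\<^sub>R i) \<bullet> x" for x :: 'b
          by (simp add: inner_sum_left inner_commute[of x])
        then show ?thesis
          using eq by presburger
      qed
    qed (use assms finite_measure_eqI_char in auto)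
    then show "emeasure M X = emeasure N X"
      by (simp add: X box_def sp M.emeasure_eq_measure N.emeasure_eq_measure)
  qed (auto simp: M.emeasure_eq_measure)
qed

text \<open>Finite-dimensional events determine a finite measure on the full product, but the set of
  continuous paths need not be measurable there. Hence both measures are carried to the product by
  the identity, compared there, and brought back: every set of the path space is the trace of a
  product set, which has the same mass under the transported measure.\<close>

lemma path_measure_eqI_char:
  fixes P Q :: "('d::finite, 'k::finite) path measure"
  assumes P: "finite_measure P" "sets P = sets (path_space W)"
    and Q: "finite_measure Q" "sets Q = sets (path_space W)"
    and eq: "\<And>F t. finite F \<Longrightarrow> F \<subseteq> W \<Longrightarrow>
      (CLINT g|P. iexp (\<Sum>\<alpha>\<in>F. t \<alpha> \<bullet> g \<alpha>)) = (CLINT g|Q. iexp (\<Sum>\<alpha>\<in>F. t \<alpha> \<bullet> g \<alpha>))"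
  shows "P = Q"
proof -
  define E where "E = (\<lambda>L :: ('d, 'k) path measure. distr L (Pi\<^sub>M W (\<lambda>_. borel)) (\<lambda>g. g))"
  have id: "(\<lambda>g. g) \<in> L \<rightarrow>\<^sub>M Pi\<^sub>M W (\<lambda>_. borel)" if "sets L = sets (path_space W)"
      for L :: "('d, 'k) path measure"
    unfolding measurable_cong_sets[OF that refl] path_space_def by (intro measurable_restrict_space1) simp
  have ev: "(\<lambda>g. g \<alpha>) \<in> borel_measurable L" if "sets L = sets (path_space W)" "\<alpha> \<in> W"
      for L :: "('d, 'k) path measure" and \<alpha>
    using measurable_compose[OF id[OF that(1)] measurable_component_singleton[OF that(2)]] .
  have sp: "space L \<subseteq> space (Pi\<^sub>M W (\<lambda>_. borel))" if "sets L = sets (path_space W)"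
      for L :: "('d, 'k) path measure"
    using sets_eq_imp_space_eq[OF that] by (auto simp: path_space_def space_restrict_space)
  have "E P = E Q"
  proof (rule measure_eqI_PiM_infinite)
    fix A :: "real ^ 'd \<Rightarrow> (real ^ 'k) set" and J
    assume J: "finite J" "J \<subseteq> W" and A: "\<And>i. i \<in> J \<Longrightarrow> A i \<in> sets borel"
    have e: "emeasure (E L) (prod_emb W (\<lambda>_. borel) J (Pi\<^sub>E J A)) =
        measure L {g \<in> space L. \<forall>\<alpha>\<in>J. g \<alpha> \<in> A \<alpha>}"
      if L: "finite_measure L" "sets L = sets (path_space W)" for L
    proof -
      have "(\<lambda>g. g) -` prod_emb W (\<lambda>_. borel) J (Pi\<^sub>E J A) \<inter> space L =
          {g \<in> space L. \<forall>\<alpha>\<in>J. g \<alpha> \<in> A \<alpha>}"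
        using sp[OF L(2)] J by (auto simp: prod_emb_def space_PiM PiE_iff)
      then show ?thesis
        unfolding E_def using id[OF L(2)] J A
        by (subst emeasure_distr)
            (auto intro!: sets_PiM_I simp: finite_measure.emeasure_eq_measure[OF L(1)])
    qed
    have "measure P {g \<in> space P. \<forall>\<alpha>\<in>J. g \<alpha> \<in> A \<alpha>} = measure Q {g \<in> space Q. \<forall>\<alpha>\<in>J. g \<alpha> \<in> A \<alpha>}"
      by (rule measure_joint_eqI_char[OF finite_measure_eqI_char_euclidean])
         (use J A P Q ev eq in auto)
    then show "emeasure (E P) (prod_emb W (\<lambda>_. borel) J (Pi\<^sub>E J A)) =
        emeasure (E Q) (prod_emb W (\<lambda>_. borel) J (Pi\<^sub>E J A))"
      using e P Q by simp
  qed (use P id in \<open>auto simp: E_def finite_measure.finite_measure_distr\<close>)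
  show ?thesis
  proof (rule measure_eqI)
    fix X assume "X \<in> sets P"
    then obtain Y where Y: "Y \<in> sets (Pi\<^sub>M W (\<lambda>_. borel))" "X = {g. continuous_on W g} \<inter> Y"
      by (auto simp: P path_space_def sets_restrict_space)
    have "emeasure (E L) Y = emeasure L X" if L: "sets L = sets (path_space W)" for L
    proof -
      have "(\<lambda>g. g) -` Y \<inter> space L = X"
        using sets_eq_imp_space_eq[OF L] Y sets.sets_into_space[OF Y(1)]
        by (auto simp: path_space_def space_restrict_space)
      then show ?thesis
        unfolding E_def using id[OF L] Y by (subst emeasure_distr) auto
    qed
    then show "emeasure P X = emeasure Q X"
      using \<open>E P = E Q\<close> P Q by metis
  qed (simp add: P Q)
qed

section \<open>Centered Gaussian variables and their covariances\<close>

lemma (in prob_space) gaussian_rv_integrable: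
  assumes "gaussian_rv M X"
  shows "integrable M X"
proof -
  have [measurable]: "X \<in> borel_measurable M"
    using assms by (simp add: gaussian_rv_def)
  consider \<mu> where "AE \<omega> in M. X \<omega> = \<mu>"
    | \<mu> \<sigma> where "0 < \<sigma>" "distributed M lborel X (\<lambda>x. ennreal (normal_density \<mu> \<sigma> x))"
    using assms by (auto simp: gaussian_rv_def)
  then show ?thesis
  proof cases
    case 1
    then have "integrable M X \<longleftrightarrow> integrable M (\<lambda>_. \<mu>)"
      by (intro integrable_cong_AE) auto
    then show ?thesis by simp
  next
    case 2
    then show ?thesis
      using distributed_integrable[OF 2(2), of "\<lambda>x. x"]
          integrable_normal_moment_nz_1[OF 2(1)] by simp
  qed
qed

text \<open>One formula serves both kinds of normal variable. A centered almost sure constant is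
  \<open>0\<close>, with transform \<open>1\<close>; otherwise \<open>X / \<sigma>\<close> is
  standard normal and the transform of \<open>X\<close> is that of \<open>X / \<sigma>\<close>
  evaluated at \<open>\<sigma>\<close>. As the mean is zero, the second moment is the
  variance.\<close>

lemma (in prob_space) gaussian_rv_centered:
  assumes X: "gaussian_rv M X" and mean: "(LINT \<omega>|M. X \<omega>) = 0"
  shows "integrable M (\<lambda>\<omega>. (X \<omega>)\<^sup>2)"
    and "(CLINT \<omega>|M. iexp (X \<omega>)) = exp (- of_real (LINT \<omega>|M. (X \<omega>)\<^sup>2) / 2)"
proof -
  have [measurable]: "X \<in> borel_measurable M"
    using X by (simp add: gaussian_rv_def)
  consider \<mu> where "AE \<omega> in M. X \<omega> = \<mu>"
    | \<mu> \<sigma> where "0 < \<sigma>" "distributed M lborel X (\<lambda>x. ennreal (normal_density \<mu> \<sigma> x))"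
    using X by (auto simp: gaussian_rv_def)
  then have "integrable M (\<lambda>\<omega>. (X \<omega>)\<^sup>2) \<and>
    (CLINT \<omega>|M. iexp (X \<omega>)) = exp (- of_real (LINT \<omega>|M. (X \<omega>)\<^sup>2) / 2)"
  proof cases
    case 1
    have "(LINT \<omega>|M. X \<omega>) = (LINT \<omega>|M. \<mu>)"
      using 1 by (intro integral_cong_AE) auto
    then have "\<mu> = 0"
      using mean by (simp add: prob_space)
    then have ae: "AE \<omega> in M. X \<omega> = 0" using 1 by simp
    have "integrable M (\<lambda>\<omega>. (X \<omega>)\<^sup>2) \<longleftrightarrow> integrable M (\<lambda>_. 0 :: real)"
      "(LINT \<omega>|M. (X \<omega>)\<^sup>2) = (LINT \<omega>|M. 0)"
      "(CLINT \<omega>|M. iexp (X \<omega>)) = (CLINT \<omega>|M. 1)"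
      using ae by (intro integrable_cong_AE integral_cong_AE; auto)+
    then show ?thesis by (simp add: prob_space)
  next
    case 2
    have \<mu>: "\<mu> = 0"
      using normal_distributed_expectation[OF 2] mean by simp
    have var: "(LINT \<omega>|M. (X \<omega>)\<^sup>2) = \<sigma>\<^sup>2"
      using normal_distributed_variance[OF 2] mean by simp
    have int: "integrable M (\<lambda>\<omega>. (X \<omega>)\<^sup>2)"
      using distributed_integrable[OF 2(2), of "\<lambda>x. x\<^sup>2"]
          integrable_normal_moment[OF 2(1), of \<mu> 2] \<mu> by simp
    have "distributed M lborel (\<lambda>x. X x / \<sigma>) std_normal_density"
      using normal_standard_normal_convert[OF 2(1), of X \<mu>] 2(2) \<mu> by simp
    then have D: "distr M lborel (\<lambda>x. X x / \<sigma>) = std_normal_distribution"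
      by (simp add: distributed_def)
    have "(CLINT \<omega>|M. iexp (X \<omega>)) = (CLINT x|distr M lborel (\<lambda>x. X x / \<sigma>). iexp (\<sigma> * x))"
      using 2(1) by (subst integral_distr) auto
    also have "\<dots> = of_real (exp (- (\<sigma>\<^sup>2) / 2))"
      unfolding D using fun_cong[OF char_std_normal_distribution, of \<sigma>] by (simp add: char_def)
    finally show ?thesis
      using int var by (simp flip: exp_of_real)
  qed
  then show "integrable M (\<lambda>\<omega>. (X \<omega>)\<^sup>2)"
    and "(CLINT \<omega>|M. iexp (X \<omega>)) = exp (- of_real (LINT \<omega>|M. (X \<omega>)\<^sup>2) / 2)"
    by auto
qed

text \<open>The integral of a non-integrable function is \<open>0\<close>, so the mean says nothing about
  integrability, which has to come from normality.\<close>

lemma (in prob_space) gaussian_vector_centered: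
  fixes X :: "'a \<Rightarrow> 'b::euclidean_space"
  assumes "X \<in> borel_measurable M" and g: "\<And>u. gaussian_rv M (\<lambda>\<omega>. u \<bullet> X \<omega>)"
    and mean: "(LINT \<omega>|M. X \<omega>) = 0"
  shows "(LINT \<omega>|M. u \<bullet> X \<omega>) = 0"
proof -
  have "integrable M (\<lambda>\<omega>. \<Sum>b\<in>Basis. (b \<bullet> X \<omega>) *\<^sub>R b)"
    using gaussian_rv_integrable[OF g] by auto
  then have "integrable M X"
    by (simp add: inner_commute[of _ "X _"] euclidean_representation)
  then show ?thesis
    using mean by simp
qed

text \<open>\<open>cross_cov\<close> centers its arguments entry by entry; with zero means the
  entries are plain product moments, and expanding in coordinates gives the bilinear form. This
  connects the matrix \<open>C\<close> with the linear functionals used for Gaussianity.\<close>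

lemma cross_cov_bilinear:
  fixes X :: "'w \<Rightarrow> real ^ 'k::finite" and Y :: "'w \<Rightarrow> real ^ 'l::finite"
  assumes X: "\<And>u. (LINT \<omega>|M. u \<bullet> X \<omega>) = 0" and Y: "\<And>u. (LINT \<omega>|M. u \<bullet> Y \<omega>) = 0"
    and int: "\<And>u v. integrable M (\<lambda>\<omega>. (u \<bullet> X \<omega>) * (v \<bullet> Y \<omega>))"
  shows "(LINT \<omega>|M. (u \<bullet> X \<omega>) * (v \<bullet> Y \<omega>)) = u \<bullet> (cross_cov M X Y *v v)"
proof -
  have int': "integrable M (\<lambda>\<omega>. X \<omega> $ i * Y \<omega> $ j)" for i j
    using int[of "axis i 1" "axis j 1"] by (simp add: inner_axis')
  have "(LINT \<omega>|M. (u \<bullet> X \<omega>) * (v \<bullet> Y \<omega>)) =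
      (LINT \<omega>|M. (\<Sum>i\<in>UNIV. \<Sum>j\<in>UNIV. u $ i * v $ j * (X \<omega> $ i * Y \<omega> $ j)))"
    by (simp add: inner_vec_def sum_product mult_ac)
  also have "\<dots> = (\<Sum>i\<in>UNIV. \<Sum>j\<in>UNIV. u $ i * v $ j * (LINT \<omega>|M. X \<omega> $ i * Y \<omega> $ j))"
    using int'
    by (subst Bochner_Integration.integral_sum;
        (intro Bochner_Integration.integrable_sum integrable_mult_right)?) simp_all
  also have "\<dots> = u \<bullet> (cross_cov M X Y *v v)"
  proof -
    have "(LINT \<omega>|M. X \<omega> $ i) = 0" "(LINT \<omega>|M. Y \<omega> $ j) = 0" for i j
      using X[of "axis i 1"] Y[of "axis j 1"] by (simp_all add: inner_axis')
    then show ?thesis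
      by (simp add: inner_vec_def cross_cov_def matrix_vector_mult_def sum_distrib_left mult_ac)
  qed
  finally show ?thesis .
qed

section \<open>Measurability into and out of the path space\<close>

lemma measurable_path_spaceI:
  assumes "\<And>\<alpha>. \<alpha> \<in> W \<Longrightarrow> (\<lambda>x. f x \<alpha>) \<in> borel_measurable M"
    and "\<And>x. x \<in> space M \<Longrightarrow> continuous_on W (f x)"
  shows "(\<lambda>x. restrict (f x) W) \<in> M \<rightarrow>\<^sub>M path_space W"
  unfolding path_space_def
  by (rule measurable_restrict_space2)
     (use assms in \<open>auto simp: Pi_iff cong: continuous_on_cong intro!: measurable_restrict\<close>)

lemma space_path_space: "space (path_space W) = {g \<in> extensional W. continuous_on W g}"
  by (auto simp: path_space_def space_restrict_space space_PiM PiE_def)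

lemma measurable_path_eval [measurable]:
  assumes "\<alpha> \<in> W"
  shows "(\<lambda>g. g \<alpha>) \<in> borel_measurable (path_space W)"
  unfolding path_space_def
  by (rule measurable_restrict_space1) (use assms in measurable)

lemma measurable_matrix_vector [measurable]:
  fixes A :: "real ^ 'n ^ 'm"
  shows "(\<lambda>y. A *v y) \<in> borel_measurable borel"
  by (intro borel_measurable_continuous_onI linear_continuous_on matrix_vector_mul_bounded_linear)

section \<open>The limit experiment: second moments of the noise and their continuity\<close>

locale limit_experiment =
  fixes M :: "'w measure" and W :: "(real ^ 'd::finite) set" and a0 :: "real ^ 'd"
    and G :: "'w \<Rightarrow> ('d, 'k::finite) path"
    and C :: "real ^ 'd \<Rightarrow> real ^ 'd \<Rightarrow> real ^ 'k ^ 'k"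
  assumes noise: "limit_noise M W G C" and a0: "a0 \<in> W" and inv: "invertible (C a0 a0)"
begin

sublocale prob_space M
  using noise by (simp add: limit_noise_def)

lemma measurable_noise [measurable]: "\<alpha> \<in> W \<Longrightarrow> (\<lambda>\<omega>. G \<omega> \<alpha>) \<in> borel_measurable M"
  using noise by (simp add: limit_noise_def gaussian_process_def)

lemma continuous_noise: "\<omega> \<in> space M \<Longrightarrow> continuous_on W (G \<omega>)"
  using noise by (simp add: limit_noise_def)

lemma gaussian_noise: "finite F \<Longrightarrow> F \<subseteq> W \<Longrightarrow> gaussian_rv M (\<lambda>\<omega>. \<Sum>\<alpha>\<in>F. u \<alpha> \<bullet> G \<omega> \<alpha>)"
  using noise by (simp add: limit_noise_def gaussian_process_def)

lemma gaussian_noise_at: "\<alpha> \<in> W \<Longrightarrow> gaussian_rv M (\<lambda>\<omega>. u \<bullet> G \<omega> \<alpha>)"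
  using gaussian_noise[of "{\<alpha>}" "\<lambda>_. u"] by simp

lemma mean_noise_at: "\<alpha> \<in> W \<Longrightarrow> (LINT \<omega>|M. u \<bullet> G \<omega> \<alpha>) = 0"
  using noise gaussian_noise_at by (intro gaussian_vector_centered) (auto simp: limit_noise_def)

lemma integrable_noise_at: "\<alpha> \<in> W \<Longrightarrow> integrable M (\<lambda>\<omega>. u \<bullet> G \<omega> \<alpha>)"
  using gaussian_noise_at gaussian_rv_integrable by blast

text \<open>\<open>gaussian_process\<close> allows one coefficient per point, and \<open>a0\<close>
  may or may not belong to \<open>F\<close>. On \<open>insert a0 F\<close> the coefficients are
  added, which treats both cases at once.\<close>

lemma gaussian_combination:
  assumes "finite F" "F \<subseteq> W"
  shows "gaussian_rv M (\<lambda>\<omega>. (\<Sum>\<alpha>\<in>F. u \<alpha> \<bullet> G \<omega> \<alpha>) + w \<bullet> G \<omega> a0)"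
proof -
  have "(\<Sum>\<alpha>\<in>insert a0 F. ((if \<alpha> \<in> F then u \<alpha> else 0) + (if \<alpha> = a0 then w else 0)) \<bullet> G \<omega> \<alpha>) =
      (\<Sum>\<alpha>\<in>F. u \<alpha> \<bullet> G \<omega> \<alpha>) + w \<bullet> G \<omega> a0" for \<omega>
  proof -
    have "(\<Sum>\<alpha>\<in>insert a0 F. (if \<alpha> \<in> F then u \<alpha> else 0) \<bullet> G \<omega> \<alpha>) = (\<Sum>\<alpha>\<in>F. u \<alpha> \<bullet> G \<omega> \<alpha>)"
      by (rule sum.mono_neutral_cong_right) (use assms in auto)
    moreover have "(\<Sum>\<alpha>\<in>insert a0 F. (if \<alpha> = a0 then w else 0) \<bullet> G \<omega> \<alpha>) = (\<Sum>\<alpha>\<in>{a0}. w \<bullet> G \<omega> \<alpha>)"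
      by (rule sum.mono_neutral_cong_right) (use assms in auto)
    ultimately show ?thesis
      by (simp add: inner_add_left sum.distrib)
  qed
  then show ?thesis
    using gaussian_noise[of "insert a0 F" "\<lambda>\<alpha>. (if \<alpha> \<in> F then u \<alpha> else 0) + (if \<alpha> =
        a0 then w else 0)"] assms a0
    by simp
qed

lemma mean_combination:
  assumes "finite F" "F \<subseteq> W"
  shows "(LINT \<omega>|M. (\<Sum>\<alpha>\<in>F. u \<alpha> \<bullet> G \<omega> \<alpha>) + w \<bullet> G \<omega> a0) = 0"
proof -
  have "integrable M (\<lambda>\<omega>. u \<alpha> \<bullet> G \<omega> \<alpha>)" if "\<alpha> \<in> F" for \<alpha>
    using integrable_noise_at that assms by blast
  moreover have "(LINT \<omega>|M. u \<alpha> \<bullet> G \<omega> \<alpha>) = 0" if "\<alpha> \<in> F" for \<alpha>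
    using mean_noise_at that assms by blast
  ultimately show ?thesis
    using integrable_noise_at[OF a0] mean_noise_at[OF a0]
    by (subst Bochner_Integration.integral_add) auto
qed

lemmas combination_centered = gaussian_rv_centered[OF gaussian_combination mean_combination]

lemma combination_at:
  assumes "\<alpha> \<in> W"
  shows "integrable M (\<lambda>\<omega>. (u \<bullet> G \<omega> \<alpha> + w \<bullet> G \<omega> a0)\<^sup>2)"
    and "(CLINT \<omega>|M. iexp (u \<bullet> G \<omega> \<alpha> + w \<bullet> G \<omega> a0)) =
      exp (- of_real (LINT \<omega>|M. (u \<bullet> G \<omega> \<alpha> + w \<bullet> G \<omega> a0)\<^sup>2) / 2)"
  using combination_centered[of "{\<alpha>}" "\<lambda>_. u" w] assms by simp_all

text \<open>The product is a quarter of a difference of squares of centered Gaussian variables, and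
  those squares are integrable. Writing the covariance by second moments also makes its continuity
  in \<alpha> accessible.\<close>

lemma polarization:
  assumes "\<alpha> \<in> W"
  shows "integrable M (\<lambda>\<omega>. (u \<bullet> G \<omega> \<alpha>) * (w \<bullet> G \<omega> a0))"
    and "(LINT \<omega>|M. (u \<bullet> G \<omega> \<alpha>) * (w \<bullet> G \<omega> a0)) =
      ((LINT \<omega>|M. (u \<bullet> G \<omega> \<alpha> + w \<bullet> G \<omega> a0)\<^sup>2) - (LINT \<omega>|M. (u \<bullet> G \<omega> \<alpha> + (- w) \<bullet> G \<omega> a0)\<^sup>2)) / 4"
proof -
  have *: "(u \<bullet> G \<omega> \<alpha>) * (w \<bullet> G \<omega> a0) =
    ((u \<bullet> G \<omega> \<alpha> + w \<bullet> G \<omega> a0)\<^sup>2 - (u \<bullet> G \<omega> \<alpha> + (- w) \<bullet> G \<omega> a0)\<^sup>2) / 4" for \<omega>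
    by (simp add: power2_eq_square algebra_simps)
  note int = combination_at(1)[OF assms]
  show "integrable M (\<lambda>\<omega>. (u \<bullet> G \<omega> \<alpha>) * (w \<bullet> G \<omega> a0))"
    unfolding * using int by (intro integrable_divide Bochner_Integration.integrable_diff)
  show "(LINT \<omega>|M. (u \<bullet> G \<omega> \<alpha>) * (w \<bullet> G \<omega> a0)) =
      ((LINT \<omega>|M. (u \<bullet> G \<omega> \<alpha> + w \<bullet> G \<omega> a0)\<^sup>2) - (LINT \<omega>|M. (u \<bullet> G \<omega> \<alpha> + (- w) \<bullet> G \<omega> a0)\<^sup>2)) / 4"
    unfolding * integral_divide_zero by (subst Bochner_Integration.integral_diff[OF int int]) simp
qed

lemma covariance_noise:
  assumes "\<alpha> \<in> W"
  shows "(LINT \<omega>|M. (u \<bullet> G \<omega> \<alpha>) * (w \<bullet> G \<omega> a0)) = u \<bullet> (C \<alpha> a0 *v w)"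
proof -
  have "cross_cov M (\<lambda>\<omega>. G \<omega> \<alpha>) (\<lambda>\<omega>. G \<omega> a0) = C \<alpha> a0"
    using noise assms a0 by (simp add: limit_noise_def)
  then show ?thesis
    using cross_cov_bilinear[of M "\<lambda>\<omega>. G \<omega> \<alpha>" "\<lambda>\<omega>. G \<omega> a0" u w]
        mean_noise_at assms a0 polarization(1)
    by simp
qed

text \<open>Continuity of the paths passes to the variances through the characteristic
  function, since \<open>E cos Z = exp (- Var Z / 2)\<close> for centered Gaussian \<open>Z\<close> and \<open>cos\<close> is bounded.\<close>

lemma continuous_on_second_moment:
  "continuous_on W (\<lambda>\<alpha>. LINT \<omega>|M. (u \<bullet> G \<omega> \<alpha> + w \<bullet> G \<omega> a0)\<^sup>2)"
proof -
  define c where "c = (\<lambda>\<alpha>. CLINT \<omega>|M. iexp (u \<bullet> G \<omega> \<alpha> + w \<bullet> G \<omega> a0))"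
  have c: "c \<alpha> = of_real (exp (- (LINT \<omega>|M. (u \<bullet> G \<omega> \<alpha> + w \<bullet> G \<omega> a0)\<^sup>2) / 2))" if "\<alpha> \<in> W" for \<alpha>
    using combination_at(2)[OF that] by (simp add: c_def flip: exp_of_real)
  have "continuous_on W c"
    unfolding continuous_on_sequentially
  proof (intro allI impI ballI, elim conjE)
    fix x \<alpha> assume x: "\<forall>n::nat. x n \<in> W" "\<alpha> \<in> W" "x \<longlonglongrightarrow> \<alpha>"
    show "(c \<circ> x) \<longlonglongrightarrow> c \<alpha>"
      unfolding c_def comp_def
    proof (rule integral_dominated_convergence[where w="\<lambda>_. 1"])
      show "AE \<omega> in M. (\<lambda>n. iexp (u \<bullet> G \<omega> (x n) + w \<bullet> G \<omega> a0)) \<longlonglongrightarrow> iexp (u \<bullet> G \<omega> \<alpha> + w \<bullet> G \<omega> a0)"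
      proof (rule AE_I2)
        fix \<omega> assume "\<omega> \<in> space M"
        then have "(\<lambda>n. G \<omega> (x n)) \<longlonglongrightarrow> G \<omega> \<alpha>"
          using continuous_noise x unfolding continuous_on_sequentially by (auto simp: comp_def)
        then show "(\<lambda>n. iexp (u \<bullet> G \<omega> (x n) + w \<bullet> G \<omega> a0)) \<longlonglongrightarrow> iexp (u \<bullet> G \<omega> \<alpha> + w \<bullet> G \<omega> a0)"
          by (intro tendsto_intros)
      qed
    qed (use x a0 in auto)
  qed
  \<comment> \<open>On \<open>W\<close> the values of \<open>c\<close> are real and positive, so the
    logarithm recovers the second moment.\<close>
  then have "continuous_on W (\<lambda>\<alpha>. - 2 * ln (Re (c \<alpha>)))"
    by (intro continuous_intros) (use c in auto)
  then show ?thesis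
    by (rule continuous_on_eq) (simp add: c)
qed

text \<open>By \<open>polarization\<close> each component is a difference of two second moments that
  are continuous in \<alpha>. \<open>limit_noise\<close> says nothing about continuity of
  \<open>C\<close>, yet subtracting or adding \<open>V \<alpha> *v y\<close> must not lead out of
  the continuous paths.\<close>

lemma continuous_on_cov: "continuous_on W (\<lambda>\<alpha>. C \<alpha> a0 *v w)"
proof (subst continuous_on_componentwise, intro ballI)
  fix b :: "real ^ 'k"
  have "continuous_on W (\<lambda>\<alpha>. ((LINT \<omega>|M. (b \<bullet> G \<omega> \<alpha> + w \<bullet> G \<omega> a0)\<^sup>2) -
      (LINT \<omega>|M. (b \<bullet> G \<omega> \<alpha> + (- w) \<bullet> G \<omega> a0)\<^sup>2)) / 4)"
    by (intro continuous_on_divide continuous_on_diff continuous_on_second_moment continuous_on_const) simp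
  then show "continuous_on W (\<lambda>\<alpha>. (C \<alpha> a0 *v w) \<bullet> b)"
    by (rule continuous_on_eq)
       (simp only: inner_commute[of _ b] covariance_noise[symmetric] polarization(2)[symmetric])
qed

section \<open>The regression coefficient, residual paths and recombination\<close>

abbreviation "V \<equiv> V_coef C a0"

lemma V_mult: "V \<alpha> *v y = C \<alpha> a0 *v (matrix_inv (C a0 a0) *v y)"
  by (simp add: V_coef_def matrix_vector_mul_assoc)

lemma inv_cov0: "C a0 a0 ** matrix_inv (C a0 a0) = mat 1" "matrix_inv (C a0 a0) ** C a0 a0 = mat 1"
  using someI_ex[OF inv[unfolded invertible_def]] by (simp_all add: matrix_inv_def)

lemma V_a0: "V a0 *v y = y"
  by (simp add: V_coef_def inv_cov0)

text \<open>The normal equations for regressing \<open>G \<alpha>\<close> on \<open>G a0\<close>;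
  they are what makes the residual uncorrelated with \<open>G a0\<close>.\<close>

lemma V_cov: "V \<alpha> *v (C a0 a0 *v y) = C \<alpha> a0 *v y"
  by (simp add: V_coef_def matrix_vector_mul_assoc matrix_mul_assoc[symmetric] inv_cov0)

lemma continuous_on_V: "continuous_on W (\<lambda>\<alpha>. V \<alpha> *v y)"
  by (simp add: V_mult continuous_on_cov)

abbreviation "res \<equiv> residual W C a0"
abbreviation recombine :: "('d, 'k) path \<Rightarrow> real ^ 'k \<Rightarrow> ('d, 'k) path" where
  "recombine h y \<equiv> restrict (\<lambda>\<alpha>. h \<alpha> + V \<alpha> *v y) W"

lemma residual_in_path_space: "g \<in> space (path_space W) \<Longrightarrow> res g \<in> space (path_space W)"
  using continuous_on_diff[OF _ continuous_on_V]
  by (auto simp: space_path_space residual_def cong: continuous_on_cong)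

text \<open>\<open>V a0\<close> is the identity, so a residual vanishes at \<open>a0\<close>;
  conversely a path vanishing there is its own residual. Membership can then be checked without
  exhibiting a preimage.\<close>

lemma residual_paths_eq: "residual_paths W C a0 = {h \<in> space (path_space W). h a0 = 0}"
proof -
  have "h = res h" if "h \<in> space (path_space W)" "h a0 = 0" for h
    using that by (auto simp: residual_def space_path_space extensional_def restrict_def)
  then have "{h \<in> space (path_space W). h a0 = 0} \<subseteq> residual_paths W C a0"
    unfolding residual_paths_def by blast
  moreover have "residual_paths W C a0 \<subseteq> {h \<in> space (path_space W). h a0 = 0}"
    using residual_in_path_space a0 by (auto simp: residual_paths_def residual_def V_a0)
  ultimately show ?thesis by blast
qed

lemma measurable_residual_path: "res \<in> path_space W \<rightarrow>\<^sub>M path_space W"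
proof -
  have "(\<lambda>g. restrict (\<lambda>\<alpha>. g \<alpha> - V \<alpha> *v g a0) W) \<in> path_space W \<rightarrow>\<^sub>M path_space W"
  proof (rule measurable_path_spaceI)
    show "(\<lambda>g. g \<alpha> - V \<alpha> *v g a0) \<in> borel_measurable (path_space W)" if "\<alpha> \<in> W" for \<alpha>
      using that a0 by measurable
    show "continuous_on W (\<lambda>\<alpha>. g \<alpha> - V \<alpha> *v g a0)" if "g \<in> space (path_space W)" for g
      using that continuous_on_diff[OF _ continuous_on_V] by (simp add: space_path_space)
  qed
  then show ?thesis by (simp add: residual_def[abs_def])
qed

lemma measurable_residual [measurable]: "res \<in> path_space W \<rightarrow>\<^sub>M residual_space W C a0"
  unfolding residual_space_def
  by (rule measurable_restrict_space2) (auto simp: residual_paths_def measurable_residual_path)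

text \<open>Since \<open>h a0 = 0\<close> and \<open>V a0\<close> is the identity, the recombined
  path has value \<open>y\<close> at \<open>a0\<close>, and \<open>res\<close> subtracts exactly the
  shift that was added.\<close>

lemma residual_shift:
  assumes "h \<in> residual_paths W C a0"
  shows "res (recombine h y) = h"
  using assms a0 unfolding residual_paths_eq
  by (auto simp: residual_def V_a0 space_path_space extensional_def restrict_def)

lemma measurable_shift [measurable]:
  "(\<lambda>(g, y). recombine (res g) y) \<in> path_space W \<Otimes>\<^sub>M borel \<rightarrow>\<^sub>M path_space W"
  unfolding split_beta'
proof (rule measurable_path_spaceI)
  have "res (fst p) \<alpha> = fst p \<alpha> - V \<alpha> *v fst p a0" if "\<alpha> \<in> W"
      for p :: "('d, 'k) path \<times> (real ^ 'k)" and \<alpha>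
    using that by (simp add: residual_def)
  then show "(\<lambda>p. res (fst p) \<alpha> + V \<alpha> *v snd p) \<in> borel_measurable (path_space W \<Otimes>\<^sub>M borel)"
      if "\<alpha> \<in> W" for \<alpha>
    using that a0 by simp
  show "continuous_on W (\<lambda>\<alpha>. res (fst p) \<alpha> + V \<alpha> *v snd p)"
      if "p \<in> space (path_space W \<Otimes>\<^sub>M borel)" for p
    using that residual_in_path_space[of "fst p"]
    by (intro continuous_on_add continuous_on_V) (auto simp: space_path_space space_pair_measure)
qed

lemma measurable_shift_path:
  assumes "h \<in> residual_paths W C a0"
  shows "recombine h \<in> borel \<rightarrow>\<^sub>M path_space W"
  using assms unfolding residual_paths_eq
  by (intro measurable_path_spaceI continuous_on_add continuous_on_V) (auto simp: space_path_space)

lemma measurable_obs [measurable]: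
  assumes "continuous_on W m"
  shows "(\<lambda>\<omega>. restrict (\<lambda>\<alpha>. m \<alpha> + G \<omega> \<alpha>) W) \<in> M \<rightarrow>\<^sub>M path_space W"
  using assms by (intro measurable_path_spaceI continuous_on_add continuous_noise) auto

lemma prob_space_obs_law: "continuous_on W m \<Longrightarrow> prob_space (obs_law M W G m)"
  unfolding obs_law_def by (intro prob_space_distr measurable_obs)

text \<open>Pythagoras: \<open>w \<bullet> G \<omega> a0\<close> is the projection on
  \<open>G a0\<close> of the functional with coefficients \<open>u\<close>, and
  \<open>w \<bullet> (C a0 a0 *v w)\<close> is its variance.\<close>

lemma second_moment_decomposition:
  assumes F: "finite F" "F \<subseteq> W" and w: "\<And>v. w \<bullet> v = (\<Sum>\<alpha>\<in>F. u \<alpha> \<bullet> (V \<alpha> *v v))"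
  shows "(LINT \<omega>|M. (\<Sum>\<alpha>\<in>F. u \<alpha> \<bullet> G \<omega> \<alpha>)\<^sup>2) =
    (LINT \<omega>|M. ((\<Sum>\<alpha>\<in>F. u \<alpha> \<bullet> G \<omega> \<alpha>) - w \<bullet> G \<omega> a0)\<^sup>2) + w \<bullet> (C a0 a0 *v w)"
proof -
  define Y where "Y = (\<lambda>\<omega>. \<Sum>\<alpha>\<in>F. u \<alpha> \<bullet> G \<omega> \<alpha>)"
  define Z where "Z = (\<lambda>\<omega>. w \<bullet> G \<omega> a0)"
  have intYZ: "integrable M (\<lambda>\<omega>. (Y \<omega> - Z \<omega>)\<^sup>2)"
    using combination_centered(1)[OF F F, of u "- w"] by (simp add: Y_def Z_def)
  have YZ: "integrable M (\<lambda>\<omega>. Y \<omega> * Z \<omega>)"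
    unfolding Y_def Z_def sum_distrib_right
    by (intro Bochner_Integration.integrable_sum polarization(1)) (use F in auto)
  have ZZ: "integrable M (\<lambda>\<omega>. Z \<omega> * Z \<omega>)"
    unfolding Z_def by (rule polarization(1)[OF a0])
  have "(LINT \<omega>|M. Y \<omega> * Z \<omega>) = (\<Sum>\<alpha>\<in>F. LINT \<omega>|M. (u \<alpha> \<bullet> G \<omega> \<alpha>) * (w \<bullet> G \<omega> a0))"
    unfolding Y_def Z_def sum_distrib_right
    by (rule Bochner_Integration.integral_sum) (use polarization(1) F in auto)
  also have "\<dots> = (\<Sum>\<alpha>\<in>F. u \<alpha> \<bullet> (C \<alpha> a0 *v w))"
    by (rule sum.cong) (use covariance_noise F in auto)
  \<comment> \<open>The assumption on \<open>w\<close> at \<open>v = C a0 a0 *v w\<close>, followed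
    by \<open>V_cov\<close>.\<close>
  also have "\<dots> = w \<bullet> (C a0 a0 *v w)"
    by (simp add: w V_cov)
  finally have cov: "(LINT \<omega>|M. Y \<omega> * Z \<omega>) = w \<bullet> (C a0 a0 *v w)" .
  have var: "(LINT \<omega>|M. Z \<omega> * Z \<omega>) = w \<bullet> (C a0 a0 *v w)"
    unfolding Z_def by (rule covariance_noise[OF a0])
  \<comment> \<open>The last two terms contribute twice the covariance minus the variance of
    \<open>Z\<close>; these two numbers coincide, so one copy remains.\<close>
  have "(LINT \<omega>|M. (Y \<omega>)\<^sup>2) = (LINT \<omega>|M. (Y \<omega> - Z \<omega>)\<^sup>2 + (2 * (Y \<omega> * Z \<omega>) - Z \<omega> * Z \<omega>))"
    by (intro Bochner_Integration.integral_cong) (auto simp: power2_eq_square algebra_simps)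
  also have "\<dots> = (LINT \<omega>|M. (Y \<omega> - Z \<omega>)\<^sup>2) + w \<bullet> (C a0 a0 *v w)"
    using intYZ YZ ZZ cov var by simp
  finally show ?thesis
    by (simp add: Y_def Z_def)
qed

section \<open>The randomised test and its size at a fixed residual\<close>

lemma measurable_cond_test [measurable]:
  assumes [measurable]: "T \<in> borel_measurable (path_space W)"
      "c \<in> borel_measurable (residual_space W C a0)"
    "\<rho> \<in> borel_measurable (residual_space W C a0)"
  shows "cond_test W C a0 T c \<rho> \<in> borel_measurable (path_space W)"
proof -
  define c' where "c' = (\<lambda>g. c (res g))"
  have [measurable]: "c' \<in> borel_measurable (path_space W)"
    unfolding c'_def by measurable
  have [measurable]: "Measurable.pred (path_space W) (\<lambda>g. T g = c' g)"
    unfolding pred_def by (rule borel_measurable_eq) measurable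
  show ?thesis
    unfolding cond_test_def[abs_def] c'_def[THEN fun_cong, symmetric] by measurable
qed

text \<open>The two events in the test exclude each other, so its only values are \<open>0\<close>,
  \<open>1\<close> and the randomisation probability.\<close>

lemma abs_cond_test_le:
  assumes "\<And>h. h \<in> residual_paths W C a0 \<Longrightarrow> 0 \<le> \<rho> h \<and> \<rho> h \<le> 1" "g \<in> space (path_space W)"
  shows "\<bar>cond_test W C a0 T c \<rho> g\<bar> \<le> 1"
  using assms(1)[of "res g"] assms(2) by (auto simp: cond_test_def residual_paths_def)

lemma
  assumes h: "h \<in> residual_paths W C a0" and xi: "\<xi> \<in> borel_measurable Q"
  shows measurable_shift_noise: "(\<lambda>q. recombine h (\<xi> q)) \<in> Q \<rightarrow>\<^sub>M path_space W"
    and integral_cond_null_law: "f \<in> borel_measurable (path_space W) \<Longrightarrow>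
      (LINT g|cond_null_law W C a0 Q \<xi> h. f g) = (LINT q|Q. f (recombine h (\<xi> q)) :: real)"
proof -
  show *: "(\<lambda>q. recombine h (\<xi> q)) \<in> Q \<rightarrow>\<^sub>M path_space W"
    by (rule measurable_compose[OF xi measurable_shift_path[OF h]])
  show "(LINT g|cond_null_law W C a0 Q \<xi> h. f g) = (LINT q|Q. f (recombine h (\<xi> q)) :: real)"
    if "f \<in> borel_measurable (path_space W)"
    unfolding cond_null_law_def by (rule integral_distr[OF * that])
qed

text \<open>Every recombined path has residual \<open>h\<close>, so the critical value and the
  randomisation probability are constants under the integral. This puts the size hypothesis in the
  form that arises as the inner integral of the disintegration.\<close>

lemma integral_cond_test_shift:
  assumes h: "h \<in> residual_paths W C a0" and xi: "\<xi> \<in> borel_measurable Q" and Q: "prob_space Q"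
    and T [measurable]: "T \<in> borel_measurable (path_space W)"
  shows "(LINT q|Q. cond_test W C a0 T c \<rho> (recombine h (\<xi> q))) =
      measure (cond_null_law W C a0 Q \<xi> h) {g \<in> space (path_space W). T g > c h}
    + \<rho> h * measure (cond_null_law W C a0 Q \<xi> h) {g \<in> space (path_space W). T g = c h}"
proof -
  interpret Q: prob_space Q by fact
  have sh: "(\<lambda>q. recombine h (\<xi> q)) \<in> Q \<rightarrow>\<^sub>M path_space W"
    by (rule measurable_shift_noise[OF h xi])
  define Z where "Z = (\<lambda>q. T (recombine h (\<xi> q)))"
  have [measurable]: "Z \<in> borel_measurable Q"
    unfolding Z_def using sh by measurable
  have m: "measure (cond_null_law W C a0 Q \<xi> h) {g \<in> space (path_space W). R (T g)} =
      (LINT q|Q. of_bool (R (Z q)))" if R [measurable]: "Measurable.pred borel R" for R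
  proof -
    have "measure (cond_null_law W C a0 Q \<xi> h) {g \<in> space (path_space W). R (T g)} =
        measure Q {q \<in> space Q. R (Z q)}"
      unfolding cond_null_law_def
      by (subst measure_distr[OF sh])
         (auto simp: Z_def intro!: arg_cong[where f="measure Q"] measurable_space[OF sh])
    also have "\<dots> = (LINT q|Q. indicator {q \<in> space Q. R (Z q)} q)"
      by simp
    also have "\<dots> = (LINT q|Q. of_bool (R (Z q)))"
      by (intro Bochner_Integration.integral_cong) (auto simp: indicator_def)
    finally show ?thesis .
  qed
  have int: "integrable Q (\<lambda>q. of_bool (R (Z q)) :: real)"
      if R [measurable]: "Measurable.pred borel R" for R
    by (rule Q.integrable_const_bound[where B=1]) auto
  have "(LINT q|Q. cond_test W C a0 T c \<rho> (recombine h (\<xi> q))) =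
      (LINT q|Q. of_bool (Z q > c h) + \<rho> h * of_bool (Z q = c h))"
    unfolding cond_test_def residual_shift[OF h] Z_def ..
  also have "\<dots> = (LINT q|Q. of_bool (Z q > c h)) + \<rho> h * (LINT q|Q. of_bool (Z q = c h))"
    using int[of "\<lambda>z. z > c h"] int[of "\<lambda>z. z = c h"] by simp
  also have "\<dots> = measure (cond_null_law W C a0 Q \<xi> h) {g \<in> space (path_space W). T g > c h}
    + \<rho> h * measure (cond_null_law W C a0 Q \<xi> h) {g \<in> space (path_space W). T g = c h}"
    using m[of "\<lambda>z. z > c h"] m[of "\<lambda>z. z = c h"] by simp
  finally show ?thesis .
qed

end

section \<open>Disintegration of the law of the observed path under a null mean\<close>

text \<open>The auxiliary noise \<open>\<xi>\<close> lives on a space \<open>Q\<close> of its own,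
  so that the product of \<open>P\<close> and \<open>Q\<close> makes it independent of the observed
  path.\<close>

locale null_experiment = limit_experiment M W a0 G C + Q: prob_space Q
  for M :: "'w measure" and W :: "(real ^ 'd::finite) set" and a0 :: "real ^ 'd"
    and G :: "'w \<Rightarrow> ('d, 'k::finite) path"
    and C :: "real ^ 'd \<Rightarrow> real ^ 'd \<Rightarrow> real ^ 'k ^ 'k" and Q :: "'q measure" +
  fixes \<xi> :: "'q \<Rightarrow> real ^ 'k" and m :: "('d, 'k) path"
  assumes xi: "normal_vector Q \<xi> 0 (C a0 a0)" and null: "null_mean W a0 m"
begin

abbreviation "P \<equiv> obs_law M W G m"

lemma continuous_mean: "continuous_on W m" and mean_a0: "m a0 = 0"
  using null by (auto simp: null_mean_def)

sublocale P: prob_space P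
  by (rule prob_space_obs_law[OF continuous_mean])

sublocale PQ: pair_prob_space P Q ..

lemma sets_P [measurable_cong, simp]: "sets P = sets (path_space W)"
  by (simp add: obs_law_def)

lemma space_P [simp]: "space P = space (path_space W)"
  by (simp add: obs_law_def)

lemma measurable_xi [measurable]: "\<xi> \<in> borel_measurable Q"
  using xi by (simp add: normal_vector_def)

text \<open>Polarization yields the integrability of products, after which bilinearity turns the
  variance of \<open>w \<bullet> \<xi>\<close> into the quadratic form of
  \<open>C a0 a0\<close>.\<close>

lemma char_xi: "(CLINT q|Q. iexp (w \<bullet> \<xi> q)) = exp (- of_real (w \<bullet> (C a0 a0 *v w)) / 2)"
proof -
  have g: "gaussian_rv Q (\<lambda>q. u \<bullet> \<xi> q)" for u
    using xi by (simp add: normal_vector_def)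
  have mean: "(LINT q|Q. u \<bullet> \<xi> q) = 0" for u
    using xi by (intro Q.gaussian_vector_centered) (auto simp: normal_vector_def)
  note gauss = Q.gaussian_rv_centered[OF g mean]
  have "integrable Q (\<lambda>q. (u \<bullet> \<xi> q) * (v \<bullet> \<xi> q))" for u v
  proof -
    have eq: "(u \<bullet> \<xi> q) * (v \<bullet> \<xi> q) = (((u + v) \<bullet> \<xi> q)\<^sup>2 - (u \<bullet> \<xi> q)\<^sup>2 - (v \<bullet> \<xi> q)\<^sup>2) / 2" for q
      by (simp add: power2_eq_square algebra_simps inner_add_left)
    show ?thesis
      unfolding eq using gauss(1) by (intro integrable_divide Bochner_Integration.integrable_diff)
  qed
  then have "(LINT q|Q. (w \<bullet> \<xi> q) * (w \<bullet> \<xi> q)) = w \<bullet> (cross_cov Q \<xi> \<xi> *v w)"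
    using mean by (intro cross_cov_bilinear)
  then show ?thesis
    using gauss(2)[of w] xi by (simp add: normal_vector_def power2_eq_square)
qed

lemma measurable_recombine [measurable]: "(\<lambda>(g, q). recombine (res g) (\<xi> q)) \<in> P \<Otimes>\<^sub>M Q \<rightarrow>\<^sub>M path_space W"
proof -
  have "(\<lambda>p. (\<lambda>(g, y). recombine (res g) y) (fst p, \<xi> (snd p))) \<in> P \<Otimes>\<^sub>M Q \<rightarrow>\<^sub>M path_space W"
    by measurable
  then show ?thesis
    by (simp add: split_beta')
qed

text \<open>In a linear functional of the path, recombining replaces \<open>w \<bullet> g a0\<close>
  by \<open>w \<bullet> \<xi>\<close>. Removing the former lowers the variance by
  \<open>w \<bullet> (C a0 a0 *v w)\<close>, and the independent latter restores it.\<close>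

lemma obs_law_recombine: "P = distr (P \<Otimes>\<^sub>M Q) (path_space W) (\<lambda>(g, q). recombine (res g) (\<xi> q))"
proof (rule path_measure_eqI_char)
  show "finite_measure (distr (P \<Otimes>\<^sub>M Q) (path_space W) (\<lambda>(g, q). recombine (res g) (\<xi> q)))"
    by (intro finite_measure.finite_measure_distr) (auto intro: PQ.P.finite_measure_axioms)
  fix F and u :: "real ^ 'd \<Rightarrow> real ^ 'k" assume F: "finite F" "F \<subseteq> W"
  \<comment> \<open>The transposes gather the functional of the path \<open>V \<alpha> *v v\<close>
    into a single inner product with \<open>v\<close>.\<close>
  define w where "w = (\<Sum>\<alpha>\<in>F. transpose (V \<alpha>) *v u \<alpha>)"
  have w: "w \<bullet> v = (\<Sum>\<alpha>\<in>F. u \<alpha> \<bullet> (V \<alpha> *v v))" for v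
    by (simp add: w_def inner_sum_left dot_lmul_matrix)
  define \<mu> where "\<mu> = (\<Sum>\<alpha>\<in>F. u \<alpha> \<bullet> m \<alpha>)"
  define Y where "Y = (\<lambda>\<omega>. \<Sum>\<alpha>\<in>F. u \<alpha> \<bullet> G \<omega> \<alpha>)"
  have [measurable]: "Y \<in> borel_measurable M"
    using F unfolding Y_def by (intro borel_measurable_sum) auto
  have [measurable]: "(\<lambda>g. g \<alpha>) \<in> borel_measurable (path_space W)" if "\<alpha> \<in> F" for \<alpha>
    using that F by auto
  note [measurable] = measurable_path_eval[OF a0]
      measurable_noise[OF a0] measurable_obs[OF continuous_mean]
  have obs: "(\<Sum>\<alpha>\<in>F. u \<alpha> \<bullet> restrict (\<lambda>\<alpha>. m \<alpha> + G \<omega> \<alpha>) W \<alpha>) = \<mu> + Y \<omega>" for \<omega>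
  proof -
    have "(\<Sum>\<alpha>\<in>F. u \<alpha> \<bullet> restrict (\<lambda>\<alpha>. m \<alpha> + G \<omega> \<alpha>) W \<alpha>) = (\<Sum>\<alpha>\<in>F. u \<alpha> \<bullet> m \<alpha> + u \<alpha> \<bullet> G \<omega> \<alpha>)"
      by (rule sum.cong) (use F in \<open>auto simp: inner_add_right\<close>)
    then show ?thesis
      by (simp add: \<mu>_def Y_def sum.distrib)
  qed
  have recomb: "(\<Sum>\<alpha>\<in>F. u \<alpha> \<bullet> recombine (res g) y \<alpha>) = ((\<Sum>\<alpha>\<in>F. u \<alpha> \<bullet> g \<alpha>) - w \<bullet> g a0) + w \<bullet> y"
      for g y
  proof -
    have "(\<Sum>\<alpha>\<in>F. u \<alpha> \<bullet> recombine (res g) y \<alpha>) =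
        (\<Sum>\<alpha>\<in>F. u \<alpha> \<bullet> g \<alpha> - u \<alpha> \<bullet> (V \<alpha> *v g a0) + u \<alpha> \<bullet> (V \<alpha> *v y))"
      by (rule sum.cong) (use F in \<open>auto simp: inner_add_right inner_diff_right residual_def\<close>)
    then show ?thesis
      by (simp add: w sum.distrib sum_subtractf)
  qed
  have split: "iexp (x + y) = iexp x * iexp y" for x y :: real
    by (simp add: distrib_left exp_add)
  have Y: "(CLINT \<omega>|M. iexp (Y \<omega>)) = exp (- of_real (LINT \<omega>|M. (Y \<omega>)\<^sup>2) / 2)"
    using combination_centered(2)[OF F F, of u 0] by (simp add: Y_def)
  have YZ: "(CLINT \<omega>|M. iexp (Y \<omega> - w \<bullet> G \<omega> a0)) =
      exp (- of_real (LINT \<omega>|M. (Y \<omega> - w \<bullet> G \<omega> a0)\<^sup>2) / 2)"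
    using combination_centered(2)[OF F F, of u "- w"] by (simp add: Y_def)
  have decomp: "(LINT \<omega>|M. (Y \<omega>)\<^sup>2) = (LINT \<omega>|M. (Y \<omega> - w \<bullet> G \<omega> a0)\<^sup>2) + w \<bullet> (C a0 a0 *v w)"
    unfolding Y_def by (rule second_moment_decomposition[OF F w])
  have "(CLINT g|P. iexp (\<Sum>\<alpha>\<in>F. u \<alpha> \<bullet> g \<alpha>)) = (CLINT \<omega>|M. iexp (\<mu> + Y \<omega>))"
    unfolding obs_law_def obs[symmetric] by (rule integral_distr) measurable
  also have "\<dots> = iexp \<mu> * exp (- of_real (LINT \<omega>|M. (Y \<omega>)\<^sup>2) / 2)"
    unfolding split Y[symmetric] by simp
  \<comment> \<open>\<open>decomp\<close> splits the exponent, and its second summand is the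
    variance of \<open>w \<bullet> \<xi>\<close>.\<close>
  also have "\<dots> = iexp \<mu> * (CLINT \<omega>|M. iexp (Y \<omega> - w \<bullet> G \<omega> a0)) * (CLINT q|Q. iexp (w \<bullet> \<xi> q))"
    unfolding YZ char_xi decomp by (simp add: exp_add[symmetric] diff_divide_distrib algebra_simps)
  also have "iexp \<mu> * (CLINT \<omega>|M. iexp (Y \<omega> - w \<bullet> G \<omega> a0)) =
      (CLINT \<omega>|M. iexp (\<mu> + (Y \<omega> - w \<bullet> G \<omega> a0)))"
    unfolding split by simp
  also have "\<dots> = (CLINT g|P. iexp ((\<Sum>\<alpha>\<in>F. u \<alpha> \<bullet> g \<alpha>) - w \<bullet> g a0))"
  proof -
    \<comment> \<open>The null hypothesis enters here: by \<open>m a0 = 0\<close> the observed value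
      at \<open>a0\<close> is pure noise, so subtracting its multiple leaves the mean
      \<open>\<mu>\<close> untouched.\<close>
    have "\<mu> + (Y \<omega> - w \<bullet> G \<omega> a0) =
        (\<Sum>\<alpha>\<in>F. u \<alpha> \<bullet> restrict (\<lambda>\<alpha>. m \<alpha> + G \<omega> \<alpha>) W \<alpha>) - w \<bullet> restrict (\<lambda>\<alpha>. m \<alpha> + G \<omega> \<alpha>) W a0" for \<omega>
      unfolding obs using a0 mean_a0 by simp
    then show ?thesis
      unfolding obs_law_def by (simp only:) (rule integral_distr[symmetric]; measurable)
  qed
  also have "\<dots> * (CLINT q|Q. iexp (w \<bullet> \<xi> q)) =
      (CLINT g|P. CLINT q|Q. iexp ((\<Sum>\<alpha>\<in>F. u \<alpha> \<bullet> g \<alpha>) - w \<bullet> g a0) * iexp (w \<bullet> \<xi> q))"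
    by simp
  also have "\<dots> = (CLINT p|P \<Otimes>\<^sub>M Q. iexp (((\<Sum>\<alpha>\<in>F. u \<alpha> \<bullet> fst p \<alpha>) - w \<bullet> fst p a0) + w \<bullet> \<xi> (snd p)))"
    unfolding split[symmetric]
    by (subst PQ.integral_fst'[symmetric]) (auto intro!: PQ.P.integrable_const_bound[where B=1])
  also have "\<dots> = (CLINT p|P \<Otimes>\<^sub>M Q. iexp (\<Sum>\<alpha>\<in>F. u \<alpha> \<bullet> (\<lambda>(g, q). recombine (res g) (\<xi> q)) p \<alpha>))"
    by (simp only: recomb split_beta')
  also have "\<dots> =
      (CLINT g|distr (P \<Otimes>\<^sub>M Q) (path_space W) (\<lambda>(g, q). recombine (res g) (\<xi> q)). iexp (\<Sum>\<alpha>\<in>F. u \<alpha> \<bullet> g \<alpha>))"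
    by (rule integral_distr[symmetric]) measurable
  finally show "(CLINT g|P. iexp (\<Sum>\<alpha>\<in>F. u \<alpha> \<bullet> g \<alpha>)) =
    (CLINT g|distr (P \<Otimes>\<^sub>M Q) (path_space W) (\<lambda>(g, q). recombine (res g) (\<xi> q)). iexp (\<Sum>\<alpha>\<in>F. u \<alpha> \<bullet> g \<alpha>))" .
qed (auto intro: P.finite_measure_axioms)

lemma integral_disintegrate:
  fixes f :: "('d, 'k) path \<Rightarrow> real"
  assumes [measurable]: "f \<in> borel_measurable (path_space W)"
    and bnd: "\<And>g. g \<in> space (path_space W) \<Longrightarrow> \<bar>f g\<bar> \<le> B"
  shows "(LINT g|P. f g) = (LINT g|P. LINT q|Q. f (recombine (res g) (\<xi> q)))"
proof -
  have "(LINT g|P. f g) = (\<integral>p. f ((\<lambda>(g, q). recombine (res g) (\<xi> q)) p) \<partial>(P \<Otimes>\<^sub>M Q))"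
    by (subst obs_law_recombine, rule integral_distr) measurable
  also have "\<dots> = (LINT g|P. LINT q|Q. f (recombine (res g) (\<xi> q)))"
    using measurable_space[OF measurable_recombine]
    by (subst PQ.integral_fst'[symmetric])
       (auto intro!: PQ.P.integrable_const_bound[where B=B] AE_I2 bnd simp: split_beta')
  finally show ?thesis .
qed

section \<open>Conditional expectation given the residual\<close>

abbreviation "residual_algebra \<equiv> vimage_algebra (space (path_space W)) res (residual_space W C a0)"

lemma sets_residual_algebra:
  "sets residual_algebra = {res -` B \<inter> space (path_space W) |B. B \<in> sets (residual_space W C a0)}"
  by (rule sets_vimage_algebra2) (use measurable_space[OF measurable_residual] in auto)

lemma residual_algebra_subalgebra: "subalgebra P residual_algebra"
  using measurable_sets[OF measurable_residual] by (auto simp: subalgebra_def sets_residual_algebra)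

sublocale residual: finite_measure_subalgebra P residual_algebra
  by unfold_locales (rule residual_algebra_subalgebra)

text \<open>A constant is measurable for the residual algebra, so by the characterisation of
  conditional expectations only integrals over residual events have to be compared.\<close>

lemma
  assumes T: "T \<in> borel_measurable (path_space W)" "c \<in> borel_measurable (residual_space W C a0)"
    "\<rho> \<in> borel_measurable (residual_space W C a0)"
    and \<rho>: "\<And>h. h \<in> residual_paths W C a0 \<Longrightarrow> 0 \<le> \<rho> h \<and> \<rho> h \<le> 1"
    and size: "AE g in P. (LINT q|Q. cond_test W C a0 T c \<rho> (recombine (res g) (\<xi> q))) = \<zeta>"
  shows cond_rejection_eq: "AE g in P. cond_rejection W C a0 P (cond_test W C a0 T c \<rho>) g = \<zeta>"
    and rejection_eq: "(LINT g|P. cond_test W C a0 T c \<rho> g) = \<zeta>"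
proof -
  define \<phi> where "\<phi> = cond_test W C a0 T c \<rho>"
  have [measurable]: "\<phi> \<in> borel_measurable (path_space W)"
    unfolding \<phi>_def by (rule measurable_cond_test[OF T])
  have bnd: "\<bar>\<phi> g\<bar> \<le> 1" if "g \<in> space (path_space W)" for g
    unfolding \<phi>_def by (rule abs_cond_test_le[OF \<rho> that])
  have set_int: "(LINT g|P. indicator A g * \<phi> g) = (LINT g|P. indicator A g * \<zeta>)"
    if A_res: "A \<in> sets residual_algebra" for A
  proof -
    obtain B where B: "A = res -` B \<inter> space (path_space W)"
      using A_res by (auto simp: sets_residual_algebra)
    have A [measurable]: "A \<in> sets (path_space W)"
      using A_res residual_algebra_subalgebra by (auto simp: subalgebra_def)
    \<comment> \<open>Recombining keeps the residual, hence membership in \<open>A\<close>. The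
      indicator therefore leaves the inner integral, and \<open>size\<close> applies to what is
      left.\<close>
    have shift_A: "indicator A (recombine (res g) (\<xi> q)) = (indicator A g :: real)"
      if "g \<in> space (path_space W)" "q \<in> space Q" for g q
    proof -
      have "res g \<in> residual_paths W C a0"
        using that by (auto simp: residual_paths_def)
      then show ?thesis
        using that residual_shift[of "res g"]
            measurable_space[OF measurable_shift_noise[OF _ measurable_xi]]
        by (auto simp: B indicator_def)
    qed
    have "(LINT g|P. indicator A g * \<phi> g) =
        (LINT g|P. LINT q|Q. indicator A (recombine (res g) (\<xi> q)) * \<phi> (recombine (res g) (\<xi> q)))"
      using bnd by (intro integral_disintegrate[where B=1]) (auto split: split_indicator)
    also have "\<dots> = (LINT g|P. LINT q|Q. indicator A g * \<phi> (recombine (res g) (\<xi> q)))"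
      by (intro Bochner_Integration.integral_cong) (simp_all add: shift_A)
    also have "\<dots> = (LINT g|P. indicator A g * (LINT q|Q. \<phi> (recombine (res g) (\<xi> q))))"
      by simp
    also have "\<dots> = (LINT g|P. indicator A g * \<zeta>)"
    proof (rule integral_cong_AE)
      have "(\<lambda>(g, q). \<phi> (recombine (res g) (\<xi> q))) \<in> borel_measurable (P \<Otimes>\<^sub>M Q)"
        using measurable_compose[OF measurable_recombine, of \<phi> borel] by (simp add: split_beta')
      then have "(\<lambda>g. LINT q|Q. \<phi> (recombine (res g) (\<xi> q))) \<in> borel_measurable P"
        by (rule Q.borel_measurable_lebesgue_integral)
      then show "(\<lambda>g. indicator A g * (LINT q|Q. \<phi> (recombine (res g) (\<xi> q)))) \<in> borel_measurable P"
        by measurable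
    qed (use size in \<open>auto simp: \<phi>_def\<close>)
    finally show ?thesis .
  qed
  have "AE g in P. real_cond_exp P residual_algebra \<phi> g = \<zeta>"
  proof (rule residual.real_cond_exp_charact)
    show "set_lebesgue_integral P A \<phi> = set_lebesgue_integral P A (\<lambda>_. \<zeta>)"
      if "A \<in> sets residual_algebra" for A
      using set_int[OF that] by (simp add: set_lebesgue_integral_def)
    show "integrable P \<phi>"
      using bnd by (intro P.integrable_const_bound[where B=1]) auto
  qed auto
  then show "AE g in P. cond_rejection W C a0 P (cond_test W C a0 T c \<rho>) g = \<zeta>"
    by (simp add: cond_rejection_def \<phi>_def)
  \<comment> \<open>The whole space is a residual event, so the unconditional size is a case of
    \<open>set_int\<close>.\<close>
  have "(LINT g|P. \<phi> g) = (LINT g|P. indicator (space (path_space W)) g * \<phi> g)"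
    by (intro Bochner_Integration.integral_cong) auto
  also have "\<dots> = (LINT g|P. indicator (space (path_space W)) g * \<zeta>)"
    using sets.top[of residual_algebra] by (intro set_int) simp
  also have "\<dots> = (LINT g|P. \<zeta>)"
    by (intro Bochner_Integration.integral_cong) auto
  finally show "(LINT g|P. cond_test W C a0 T c \<rho> g) = \<zeta>"
    using P.prob_space by (simp add: \<phi>_def)
qed

end

text \<open>Conditional size appears in two forms, since a conditional expectation is determined
  only up to null sets: pointwise in \<open>h\<close> under the explicit law
  \<open>cond_null_law\<close>, and almost surely under the law of the observed path.\<close>

theorem proposition5p1:
  fixes W :: "(real ^ 'd::finite) set" and a0 :: "real ^ 'd"
    and \<Lambda> :: "real set" and lbar :: real
    and M :: "'w measure" and G :: "'w \<Rightarrow> ('d, 'k::finite) path"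
    and C :: "real ^ 'd \<Rightarrow> real ^ 'd \<Rightarrow> real ^ 'k ^ 'k"
    and Q :: "'q measure" and \<xi> :: "'q \<Rightarrow> real ^ 'k"
    and T :: "real \<Rightarrow> ('d, 'k) path \<Rightarrow> real"
    and c \<rho> :: "real \<Rightarrow> real \<Rightarrow> ('d, 'k) path \<Rightarrow> real"
    and H :: "('d, 'k) path set"
    and \<zeta> :: real
  assumes "compact W" and "a0 \<in> W"
    and "compact \<Lambda>" and "\<Lambda> \<subseteq> {0..lbar}"
    and "limit_noise M W G C"
    and "invertible (C a0 a0)"
    and "prob_space Q" and "normal_vector Q \<xi> 0 (C a0 a0)"
    and "\<And>l. l \<in> \<Lambda> \<Longrightarrow> T l \<in> borel_measurable (path_space W)"
    and "0 < \<zeta>" and "\<zeta> < 1"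
    and "\<And>l. l \<in> \<Lambda> \<Longrightarrow> c \<zeta> l \<in> borel_measurable (residual_space W C a0)"
    and "\<And>l. l \<in> \<Lambda> \<Longrightarrow> \<rho> \<zeta> l \<in> borel_measurable (residual_space W C a0)"
    and "\<And>l h. l \<in> \<Lambda> \<Longrightarrow> h \<in> residual_paths W C a0 \<Longrightarrow> 0 \<le> \<rho> \<zeta> l h \<and> \<rho> \<zeta> l h \<le> 1"
    and "H \<subseteq> residual_paths W C a0"
    and "\<And>m. null_mean W a0 m \<Longrightarrow> AE g in obs_law M W G m. residual W C a0 g \<in> H"
    and "\<And>h l. h \<in> H \<Longrightarrow> l \<in> \<Lambda> \<Longrightarrow>
           measure (cond_null_law W C a0 Q \<xi> h) {g \<in> space (path_space W). T l g > c \<zeta> l h}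
         + \<rho> \<zeta> l h *
           measure (cond_null_law W C a0 Q \<xi> h) {g \<in> space (path_space W). T l g = c \<zeta> l h} = \<zeta>"
  shows "\<forall>l\<in>\<Lambda>.
      (\<forall>h\<in>H. (\<integral>g. cond_test W C a0 (T l) (c \<zeta> l) (\<rho> \<zeta> l) g \<partial>cond_null_law W C a0 Q \<xi> h) = \<zeta>) \<and>
      (\<forall>m. null_mean W a0 m \<longrightarrow>
         (AE g in obs_law M W G m.
            cond_rejection W C a0 (obs_law M W G m)
              (cond_test W C a0 (T l) (c \<zeta> l) (\<rho> \<zeta> l)) g = \<zeta>) \<and>
         (\<integral>g. cond_test W C a0 (T l) (c \<zeta> l) (\<rho> \<zeta> l) g \<partial>obs_law M W G m) = \<zeta>)"
proof (intro ballI conjI allI impI)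
  interpret E: limit_experiment M W a0 G C
    by unfold_locales (use assms in auto)
  have xi: "\<xi> \<in> borel_measurable Q"
    using assms(8) by (simp add: normal_vector_def)
  fix l assume l: "l \<in> \<Lambda>"
  note meas = assms(9)[OF l] assms(12)[OF l] assms(13)[OF l]
  have size: "(\<integral>q. cond_test W C a0 (T l) (c \<zeta> l) (\<rho> \<zeta> l) (restrict (\<lambda>\<alpha>. h \<alpha> + V_coef C a0 \<alpha> *v \<xi> q) W) \<partial>Q) = \<zeta>"
    if h: "h \<in> H" for h
    using E.integral_cond_test_shift[OF _ xi assms(7) meas(1), of h] assms(15,17) h l by auto
  show "(\<integral>g. cond_test W C a0 (T l) (c \<zeta> l) (\<rho> \<zeta> l) g \<partial>cond_null_law W C a0 Q \<xi> h) = \<zeta>"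
    if h: "h \<in> H" for h
    using E.integral_cond_null_law[OF _ xi E.measurable_cond_test[OF meas], of h]
        size[OF h] assms(15) h by auto
  fix m :: "('d, 'k) path" assume m: "null_mean W a0 m"
  interpret N: null_experiment M W a0 G C Q \<xi> m
    using assms(7,8) m by (intro null_experiment.intro E.limit_experiment_axioms
        null_experiment_axioms.intro)
  \<comment> \<open>The residual lies in \<open>H\<close> almost surely, so the pointwise identity
    \<open>size\<close> holds for almost every observed path.\<close>
  have "AE g in obs_law M W G m. (\<integral>q. cond_test W C a0 (T l) (c \<zeta> l) (\<rho> \<zeta> l)
      (restrict (\<lambda>\<alpha>. residual W C a0 g \<alpha> + V_coef C a0 \<alpha> *v \<xi> q) W) \<partial>Q) = \<zeta>"
    using assms(16)[OF m] by (rule AE_mp) (simp add: size)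
  note size_AE = this
  show "AE g in obs_law M W G m. cond_rejection W C a0 (obs_law M W G m)
      (cond_test W C a0 (T l) (c \<zeta> l) (\<rho> \<zeta> l)) g = \<zeta>"
    by (rule N.cond_rejection_eq[OF meas assms(14)[OF l] size_AE])
  show "(\<integral>g. cond_test W C a0 (T l) (c \<zeta> l) (\<rho> \<zeta> l) g \<partial>obs_law M W G m) = \<zeta>"
    by (rule N.rejection_eq[OF meas assms(14)[OF l] size_AE])
qed

end
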